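(* Consider the $2$-dimensional Leibniz--Poisson algebras $L_1,L_2,L_3,L_4,L_5^{\beta},L_6^{\beta},L_7^{\alpha}$ ($\alpha,\beta\in\mathbb C$) and the zero algebra $\mathbb C^8$ (both products zero), as defined in the context. Their orbits have the following dimensions: $4$ for $L_4$; $3$ for $L_2$, $L_5^{\beta}$, $L_6^{\beta}$; $2$ for $L_1$, $L_3$, $L_7^{\alpha}$; $0$ for $\mathbb C^8$. For two algebras $T,T'$ of this list one has $T\to T'$ if and only if $T\cong T'$ or $T'$ can be reached from $T$ by a chain of the following (primary) degenerations: $L_4\to L_5^{0}$; $L_4\to L_6^{0}$; $L_5^{\beta}\to L_7^{\beta}$ and $L_6^{\beta}\to L_7^{-\beta}$ for all $\beta\in\mathbb C$; $L_2\to L_1$; $L_1\to\mathbb C^8$; $L_3\to\mathbb C^8$; $L_7^{\alpha}\to\mathbb C^8$ for all $\alpha\in\mathbb C$.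
   Context: A Leibniz--Poisson algebra is a complex vector space with a commutative associative product $\cdot$ and a bilinear bracket $[-,-]$ satisfying $[[x,y],z]=[[x,z],y]+[x,[y,z]]$ and $[x\cdot y,z]=[x,z]\cdot y+x\cdot[y,z]$. Fix a $2$-dimensional complex vector space $V$ with basis $e_1,e_2$. A $2$-dimensional such algebra is viewed as a pair $(\mu,\mu')\in \mathrm{Bil}(V\times V,V)^2\cong\mathbb C^{16}$ ($\mu$ is $\cdot$, $\mu'$ is the bracket). $\mathrm{GL}(V)$ acts by $(g*(\mu,\mu'))(x,y)=(g\mu(g^{-1}x,g^{-1}y),\,g\mu'(g^{-1}x,g^{-1}y))$; $O(T)$ is the orbit of a structure representing $T$. We write $T\to T'$ ($T$ degenerates to $T'$) if a structure representing $T'$ lies in the Zariski closure $\overline{O(T)}$. The algebras are (unlisted products are zero, $\cdot$ is commutative): $L_1: [e_1,e_1]=e_2$; $L_2: [e_1,e_2]=e_1$; $L_3: [e_1,e_2]=e_2,\ [e_2,e_1]=-e_2$; $L_4: e_1\cdot e_1=e_1,\ e_2\cdot e_2=e_2$; $L_5^{\alpha}: e_1\cdot e_1=e_1,\ e_1\cdot e_2=e_2,\ [e_2,e_1]=\alpha e_2$; $L_6^{\alpha}: e_1\cdot e_1=e_1,\ [e_2,e_1]=\alpha e_2$; $L_7^{\alpha}: e_1\cdot e_1=e_2,\ [e_1,e_1]=\alpha e_2$. *)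

theory Defs
  imports "HOL-Analysis.Analysis"
begin

section \<open>Two-dimensional algebra structures and the action of the general linear group\<close>

type_synonym V = "complex ^ 2"

text \<open>A structure is a pair consisting of the product and the bracket.\<close>

type_synonym lp_structure = "(V \<Rightarrow> V \<Rightarrow> V) \<times> (V \<Rightarrow> V \<Rightarrow> V)"

text \<open>Linearity is over the complex numbers; the constant \<open>bilinear\<close> of the library is real
  bilinearity only.\<close>

definition cbilinear :: "(V \<Rightarrow> V \<Rightarrow> V) \<Rightarrow> bool" where
  "cbilinear m \<longleftrightarrow>
     (\<forall>x. Vector_Spaces.linear (*s) (*s) (\<lambda>y. m x y)) \<and>
     (\<forall>y. Vector_Spaces.linear (*s) (*s) (\<lambda>x. m x y))"

definition Bil2 :: "lp_structure set" where
  "Bil2 = {(m, b). cbilinear m \<and> cbilinear b}"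

definition leibniz_poisson :: "lp_structure \<Rightarrow> bool" where
  "leibniz_poisson A \<longleftrightarrow> A \<in> Bil2 \<and> (case A of (m, b) \<Rightarrow>
     (\<forall>x y. m x y = m y x) \<and>
     (\<forall>x y z. m (m x y) z = m x (m y z)) \<and>
     (\<forall>x y z. b (b x y) z = b (b x z) y + b x (b y z)) \<and>
     (\<forall>x y z. b (m x y) z = m (b x z) y + m x (b y z)))"

definition GL :: "(V \<Rightarrow> V) set" where
  "GL = {g. Vector_Spaces.linear (*s) (*s) g \<and> bij g}"

definition act :: "(V \<Rightarrow> V) \<Rightarrow> lp_structure \<Rightarrow> lp_structure" where
  "act g A = ((\<lambda>x y. g (fst A (inv g x) (inv g y))), (\<lambda>x y. g (snd A (inv g x) (inv g y))))"

definition GL_orbit :: "lp_structure \<Rightarrow> lp_structure set" where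
  "GL_orbit A = (\<lambda>g. act g A) ` GL"

definition lp_isomorphic :: "lp_structure \<Rightarrow> lp_structure \<Rightarrow> bool" where
  "lp_isomorphic A B \<longleftrightarrow>
     (\<exists>\<phi>. Vector_Spaces.linear (*s) (*s) \<phi> \<and> bij \<phi> \<and>
        (\<forall>x y. \<phi> (fst A x y) = fst B (\<phi> x) (\<phi> y)) \<and>
        (\<forall>x y. \<phi> (snd A x y) = snd B (\<phi> x) (\<phi> y)))"


section \<open>Zariski topology, dimension and degenerations\<close>

text \<open>Polynomial functions in the sixteen structure constants.\<close>

inductive polyfun :: "(lp_structure \<Rightarrow> complex) \<Rightarrow> bool" where
  const: "polyfun (\<lambda>_. c)"
| coord_product: "polyfun (\<lambda>A. fst A (axis i 1) (axis j 1) $ k)"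
| coord_bracket: "polyfun (\<lambda>A. snd A (axis i 1) (axis j 1) $ k)"
| add: "polyfun f \<Longrightarrow> polyfun g \<Longrightarrow> polyfun (\<lambda>A. f A + g A)"
| mult: "polyfun f \<Longrightarrow> polyfun g \<Longrightarrow> polyfun (\<lambda>A. f A * g A)"

definition zero_locus :: "(lp_structure \<Rightarrow> complex) set \<Rightarrow> lp_structure set" where
  "zero_locus F = {A \<in> Bil2. \<forall>f\<in>F. f A = 0}"

definition zariski :: "lp_structure topology" where
  "zariski = topology (\<lambda>U. \<exists>F. (\<forall>f\<in>F. polyfun f) \<and> U = Bil2 - zero_locus F)"

lemma istopology_zariski:
  "istopology (\<lambda>U. \<exists>F. (\<forall>f\<in>F. polyfun f) \<and> U = Bil2 - zero_locus F)"
  unfolding istopology_def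
proof (intro conjI allI impI)
  fix S T
  assume "\<exists>F. (\<forall>f\<in>F. polyfun f) \<and> S = Bil2 - zero_locus F"
    and "\<exists>F. (\<forall>f\<in>F. polyfun f) \<and> T = Bil2 - zero_locus F"
  then obtain F G where F: "\<forall>f\<in>F. polyfun f" "S = Bil2 - zero_locus F"
    and G: "\<forall>f\<in>G. polyfun f" "T = Bil2 - zero_locus G" by blast
  define H where "H = {\<lambda>A. f A * g A | f g. f \<in> F \<and> g \<in> G}"
  have "\<forall>h\<in>H. polyfun h"
    using F(1) G(1) by (auto simp: H_def intro: polyfun.mult)
  moreover have "S \<inter> T = Bil2 - zero_locus H"
  proof (intro set_eqI iffI)
    fix A assume "A \<in> S \<inter> T"
    then obtain f g where "A \<in> Bil2" "f \<in> F" "g \<in> G" "f A \<noteq> 0" "g A \<noteq> 0"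
      by (auto simp: F(2) G(2) zero_locus_def)
    moreover from this have "(\<lambda>A. f A * g A) \<in> H"
      unfolding H_def by blast
    ultimately show "A \<in> Bil2 - zero_locus H"
      unfolding zero_locus_def by fastforce
  next
    fix A assume "A \<in> Bil2 - zero_locus H"
    then show "A \<in> S \<inter> T"
      by (auto simp: F(2) G(2) zero_locus_def H_def)
  qed
  ultimately show "\<exists>F. (\<forall>f\<in>F. polyfun f) \<and> S \<inter> T = Bil2 - zero_locus F" by blast
next
  fix K :: "lp_structure set set"
  assume "\<forall>U\<in>K. \<exists>F. (\<forall>f\<in>F. polyfun f) \<and> U = Bil2 - zero_locus F"
  then have "\<exists>\<F>. \<forall>U\<in>K. (\<forall>f\<in>\<F> U. polyfun f) \<and> U = Bil2 - zero_locus (\<F> U)"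
    by (rule bchoice)
  then obtain \<F> where poly: "\<forall>U\<in>K. \<forall>f\<in>\<F> U. polyfun f"
    and eq: "\<forall>U\<in>K. U = Bil2 - zero_locus (\<F> U)"
    by blast
  have "\<Union>K = (\<Union>U\<in>K. U)"
    by simp
  also have "\<dots> = (\<Union>U\<in>K. Bil2 - zero_locus (\<F> U))"
    using eq by (intro SUP_cong refl) blast
  also have "\<dots> = Bil2 - zero_locus (\<Union>U\<in>K. \<F> U)"
    by (auto simp: zero_locus_def)
  finally have "\<Union>K = Bil2 - zero_locus (\<Union>U\<in>K. \<F> U)" .
  moreover have "\<forall>f\<in>(\<Union>U\<in>K. \<F> U). polyfun f"
    using poly by simp
  ultimately show "\<exists>F. (\<forall>f\<in>F. polyfun f) \<and> \<Union>K = Bil2 - zero_locus F"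
    by (intro exI[of _ "\<Union>U\<in>K. \<F> U"] conjI)
qed

lemma openin_zariski:
  "openin zariski U \<longleftrightarrow> (\<exists>F. (\<forall>f\<in>F. polyfun f) \<and> U = Bil2 - zero_locus F)"
  unfolding zariski_def by (simp add: topology_inverse'[OF istopology_zariski])

lemma topspace_zariski: "topspace zariski = Bil2"
proof
  show "topspace zariski \<subseteq> Bil2"
    unfolding topspace_def openin_zariski by blast
  have "\<forall>f\<in>{\<lambda>_. 1}. polyfun f" "Bil2 = Bil2 - zero_locus {\<lambda>_. 1}"
    by (simp_all add: zero_locus_def polyfun.const)
  then have "openin zariski Bil2"
    unfolding openin_zariski by (intro exI conjI)
  then show "Bil2 \<subseteq> topspace zariski"
    by (rule openin_subset)
qed

lemma closedin_zariski:
  "closedin zariski Z \<longleftrightarrow> (\<exists>F. (\<forall>f\<in>F. polyfun f) \<and> Z = zero_locus F)"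
proof -
  have "Z \<subseteq> Bil2 \<and> Bil2 - Z = Bil2 - zero_locus F \<longleftrightarrow> Z = zero_locus F" for F
    unfolding zero_locus_def by blast
  then show ?thesis
    unfolding closedin_def topspace_zariski openin_zariski by blast
qed

definition irreducible_closedin :: "'a topology \<Rightarrow> 'a set \<Rightarrow> bool" where
  "irreducible_closedin X Z \<longleftrightarrow> closedin X Z \<and> Z \<noteq> {} \<and>
     (\<forall>A B. closedin X A \<and> closedin X B \<and> Z = A \<union> B \<longrightarrow> Z = A \<or> Z = B)"

text \<open>Krull dimension: the supremum of the lengths of strictly increasing chains of irreducible
  closed subsets. With this definition the empty space gets dimension \<open>0\<close>.\<close>

definition krull_dim :: "'a topology \<Rightarrow> enat" where
  "krull_dim X = Sup {enat n | n. \<exists>Z. (\<forall>i\<le>n. irreducible_closedin X (Z i)) \<and>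
                                     (\<forall>i<n. Z i \<subset> Z (Suc i))}"

definition orbit_dim :: "lp_structure \<Rightarrow> enat" where
  "orbit_dim A = krull_dim (subtopology zariski (GL_orbit A))"

definition degenerates :: "lp_structure \<Rightarrow> lp_structure \<Rightarrow> bool" where
  "degenerates A B \<longleftrightarrow> (\<exists>S. lp_isomorphic S B \<and> S \<in> zariski closure_of (GL_orbit A))"


section \<open>The list of algebras\<close>

abbreviation e1 :: V where "e1 \<equiv> axis 1 1"
abbreviation e2 :: V where "e2 \<equiv> axis 2 1"

text \<open>\<open>bil a b c d\<close> is the bilinear map whose values at \<open>(e1, e1)\<close>, \<open>(e1, e2)\<close>,
  \<open>(e2, e1)\<close>, \<open>(e2, e2)\<close> are \<open>a\<close>, \<open>b\<close>, \<open>c\<close>, \<open>d\<close>.\<close>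

definition bil :: "V \<Rightarrow> V \<Rightarrow> V \<Rightarrow> V \<Rightarrow> V \<Rightarrow> V \<Rightarrow> V" where
  "bil a b c d x y =
     (x $ 1 * y $ 1) *s a + (x $ 1 * y $ 2) *s b + (x $ 2 * y $ 1) *s c + (x $ 2 * y $ 2) *s d"

lemma bil_basis:
  "bil a b c d e1 e1 = a" "bil a b c d e1 e2 = b" "bil a b c d e2 e1 = c" "bil a b c d e2 e2 = d"
  by (simp_all add: bil_def axis_def)

lemma cbilinear_bil: "cbilinear (bil a b c d)"
  unfolding cbilinear_def
proof (intro conjI allI)
  show "Vector_Spaces.linear (*s) (*s) (\<lambda>y. bil a b c d x y)" for x
    by unfold_locales (simp_all add: bil_def vec_eq_iff algebra_simps)
  show "Vector_Spaces.linear (*s) (*s) (\<lambda>x. bil a b c d x y)" for y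
    by unfold_locales (simp_all add: bil_def vec_eq_iff algebra_simps)
qed

datatype lp_name = L1 | L2 | L3 | L4 | L5 complex | L6 complex | L7 complex | Zero

fun lp_algebra :: "lp_name \<Rightarrow> lp_structure" where
  "lp_algebra L1 = (bil 0 0 0 0, bil e2 0 0 0)"
| "lp_algebra L2 = (bil 0 0 0 0, bil 0 e1 0 0)"
| "lp_algebra L3 = (bil 0 0 0 0, bil 0 e2 (- e2) 0)"
| "lp_algebra L4 = (bil e1 0 0 e2, bil 0 0 0 0)"
| "lp_algebra (L5 \<alpha>) = (bil e1 e2 e2 0, bil 0 0 (\<alpha> *s e2) 0)"
| "lp_algebra (L6 \<alpha>) = (bil e1 0 0 0, bil 0 0 (\<alpha> *s e2) 0)"
| "lp_algebra (L7 \<alpha>) = (bil e2 0 0 0, bil (\<alpha> *s e2) 0 0 0)"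
| "lp_algebra Zero = (bil 0 0 0 0, bil 0 0 0 0)"

lemma bil_nth:
  "bil a b c d x y $ k =
     x $ 1 * y $ 1 * a $ k + x $ 1 * y $ 2 * b $ k + x $ 2 * y $ 1 * c $ k + x $ 2 * y $ 2 * d $ k"
  by (simp add: bil_def)

lemma leibniz_poisson_lp_algebra: "leibniz_poisson (lp_algebra T)"
proof -
  have e: "e1 $ 1 = 1" "e1 $ 2 = 0" "e2 $ 1 = 0" "e2 $ 2 = 1"
    by (simp_all add: axis_def)
  show ?thesis
    by (cases T; simp add: leibniz_poisson_def Bil2_def cbilinear_bil;
        simp add: vec_eq_iff forall_2 bil_nth e algebra_simps)
qed

inductive primary_degeneration :: "lp_name \<Rightarrow> lp_name \<Rightarrow> bool" where
  "primary_degeneration L4 (L5 0)"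
| "primary_degeneration L4 (L6 0)"
| "primary_degeneration (L5 \<beta>) (L7 \<beta>)"
| "primary_degeneration (L6 \<beta>) (L7 (- \<beta>))"
| "primary_degeneration L2 L1"
| "primary_degeneration L1 Zero"
| "primary_degeneration L3 Zero"
| "primary_degeneration (L7 \<alpha>) Zero"

end

theory Submission
  imports Defs "HOL-Library.Function_Algebras" "HOL-Computational_Algebra.Polynomial"
begin

text \<open>Every orbit lies in the image of a rational map on some \<open>d\<close>-space and contains the image of a
  principal open subset.
  Upper bound for its dimension: if \<open>Z 0 \<subset> \<dots> \<subset> Z n\<close> are irreducible closed sets and \<open>f i\<close> vanishes on
  \<open>Z i\<close> but not on \<open>Z (i + 1)\<close>, then the \<open>f i\<close> are algebraically independent, so their monomials with
  exponents at most \<open>k\<close> span a space of dimension \<open>(k + 1) ^ n\<close>; pulled back to \<open>d\<close>-space they lie in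
  a space of dimension \<open>O (k ^ d)\<close>. Lower bound: freezing all but the first \<open>i\<close> parameters gives
  images whose closures are irreducible, because two parameter points are joined by a line.
  Degenerations come from curves whose general point lies in the orbit, and they are excluded by
  closed isomorphism-invariant identities involving traces of multiplication operators.\<close>

section \<open>Dimension of images of rational maps\<close>

text \<open>\<open>orbit_dim\<close> is the dimension of the orbit in its subspace topology, so both
  bounds are stated for arbitrary subsets of \<open>Bil2\<close> and depend only on which points a
  map hits. The upper bound is sharp only if the map has exactly as many parameters as the orbit has
  dimensions. Removing the stabilizer leaves obstacles to a single chart: a direction in the plane
  for the orbits of dimension 3, a scalar factor for \<open>L1\<close> and \<open>L7\<close>. A
  quadratic family of directions and a cube root remove them. The traces in the excluding identities
  recover a linear form. On the orbits of \<open>L5 \<beta>\<close> and \<open>L6 \<beta>\<close>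
  product and bracket are given by a form \<open>f\<close> and a vector \<open>u\<close> with
  \<open>dot f u = 1\<close>, and the trace of multiplication by \<open>x\<close> is
  \<open>2 * dot f x\<close> and \<open>dot f x\<close> respectively. Hence the bracket is a
  polynomial expression in the product. For \<beta> = 0 that only says that the bracket vanishes;
  the second identity, multiplicativity of \<open>f\<close>, then excludes \<open>L4\<close> and the
  other family with parameter 0.\<close>

interpretation fun_vs: vector_space "\<lambda>c (f::'a \<Rightarrow> complex) x. c * f x"
  by unfold_locales (auto simp: fun_eq_iff algebra_simps)

lemma fun_sum_apply: "(\<Sum>a\<in>I. F a) x = (\<Sum>a\<in>I. F a (x::'a) :: complex)"
  by (induction I rule: infinite_finite_induct) auto

text \<open>Independence of a set ignores repetitions, so the family must be injective before its
  members can be counted: a coincidence \<open>P a = P b\<close> would be a relation with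
  coefficients 1 and -1.\<close>

lemma card_le_of_independent_family:
  fixes P :: "'i \<Rightarrow> 'a \<Rightarrow> complex"
  assumes "finite I" "finite B" and sp: "\<And>a. a \<in> I \<Longrightarrow> P a \<in> fun_vs.span B"
    and ind: "\<And>c. (\<And>x. (\<Sum>a\<in>I. c a * P a x) = 0) \<Longrightarrow> \<forall>a\<in>I. c a = 0"
  shows "card I \<le> card B"
proof -
  have inj: "inj_on P I"
  proof (rule inj_onI, rule ccontr)
    fix a b assume ab: "a \<in> I" "b \<in> I" "P a = P b" "a \<noteq> b"
    define c where "c i = (if i = a then 1 else if i = b then -1 else (0::complex))" for i
    have "(\<Sum>i\<in>I. c i * P i x) = 0" for x
    proof -
      have "(\<Sum>i\<in>I. c i * P i x) = (\<Sum>i\<in>{a,b}. c i * P i x)"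
        using ab assms(1) by (intro sum.mono_neutral_right) (auto simp: c_def)
      then show ?thesis using ab by (simp add: c_def)
    qed
    then have "c a = 0" using ind ab(1) by blast
    then show False by (simp add: c_def)
  qed
  have "fun_vs.independent (P ` I)"
  proof (rule fun_vs.independent_if_scalars_zero)
    show "finite (P ` I)" using assms(1) by simp
    fix c f assume z: "(\<Sum>f\<in>P ` I. (\<lambda>x. c f * f x)) = 0" and f: "f \<in> P ` I"
    have "(\<Sum>a\<in>I. c (P a) * P a x) = 0" for x
      using fun_cong[OF z, of x] by (simp add: sum.reindex[OF inj] fun_sum_apply)
    then have "\<forall>a\<in>I. c (P a) = 0" by (rule ind)
    then show "c f = 0" using f by auto
  qed
  then have "card (P ` I) \<le> card B"
    using fun_vs.independent_span_bound[OF assms(2)] sp by blast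
  then show ?thesis by (simp add: card_image[OF inj])
qed

section \<open>Polynomial functions on the parameter space and their degrees\<close>

inductive mpoly_fun :: "nat \<Rightarrow> ((nat \<Rightarrow> complex) \<Rightarrow> complex) \<Rightarrow> bool" for d where
  const: "mpoly_fun d (\<lambda>_. c)"
| var: "i < d \<Longrightarrow> mpoly_fun d (\<lambda>p. p i)"
| add: "mpoly_fun d f \<Longrightarrow> mpoly_fun d g \<Longrightarrow> mpoly_fun d (\<lambda>p. f p + g p)"
| mult: "mpoly_fun d f \<Longrightarrow> mpoly_fun d g \<Longrightarrow> mpoly_fun d (\<lambda>p. f p * g p)"

lemma mpoly_fun_power: "mpoly_fun d f \<Longrightarrow> mpoly_fun d (\<lambda>p. f p ^ n)"
  by (induction n) (auto intro: mpoly_fun.intros)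

text \<open>The bound is on each exponent separately, so the exponents form a box and the count
  \<open>(K + 1) ^ d\<close> is immediate.\<close>

definition monomials :: "nat \<Rightarrow> nat \<Rightarrow> ((nat \<Rightarrow> complex) \<Rightarrow> complex) set" where
  "monomials d K = (\<lambda>a p. \<Prod>i<d. p i ^ a i) ` ({..<d} \<rightarrow>\<^sub>E {..K})"

definition degrees_le :: "nat \<Rightarrow> nat \<Rightarrow> ((nat \<Rightarrow> complex) \<Rightarrow> complex) \<Rightarrow> bool" where
  "degrees_le d K f \<longleftrightarrow> f \<in> fun_vs.span (monomials d K)"

lemma finite_monomials: "finite (monomials d K)"
  unfolding monomials_def by (intro finite_imageI finite_PiE) auto

lemma card_monomials: "card (monomials d K) \<le> (K + 1) ^ d"
proof -
  have "card (monomials d K) \<le> card ({..<d} \<rightarrow>\<^sub>E {..K})"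
    unfolding monomials_def by (intro card_image_le finite_PiE) auto
  then show ?thesis by (simp add: card_PiE)
qed

lemma monomial_in_monomials:
  assumes "\<And>i. i < d \<Longrightarrow> a i \<le> K"
  shows "(\<lambda>p. \<Prod>i<d. p i ^ a i) \<in> monomials d K"
  unfolding monomials_def using assms
  by (intro image_eqI[where x = "restrict a {..<d}"]) auto

lemma degrees_le_mono: "degrees_le d K f \<Longrightarrow> K \<le> L \<Longrightarrow> degrees_le d L f"
proof -
  assume "degrees_le d K f" "K \<le> L"
  moreover have "monomials d K \<subseteq> monomials d L" if "K \<le> L"
    unfolding monomials_def using that by (intro image_mono PiE_mono) auto
  ultimately show ?thesis
    unfolding degrees_le_def using fun_vs.span_mono by blast
qed

lemma degrees_le_add: "degrees_le d K f \<Longrightarrow> degrees_le d K g \<Longrightarrow> degrees_le d K (\<lambda>p. f p + g p)"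
  unfolding degrees_le_def using fun_vs.span_add by (fastforce simp: plus_fun_def)

lemma degrees_le_const: "degrees_le d K (\<lambda>p. c)"
proof -
  have "(\<lambda>p. \<Prod>i<d. p i ^ (\<lambda>_. 0) i) \<in> monomials d K"
    by (rule monomial_in_monomials) simp
  then show ?thesis
    unfolding degrees_le_def using fun_vs.span_scale[OF fun_vs.span_base, of _ "monomials d K" c] by fastforce
qed

lemma degrees_le_var: "i < d \<Longrightarrow> degrees_le d 1 (\<lambda>p. p i)"
proof -
  assume i: "i < d"
  have "(\<lambda>p. \<Prod>j<d. p j ^ (\<lambda>j. if j = i then 1 else 0) j) \<in> monomials d 1"
    by (rule monomial_in_monomials) simp
  moreover have "(\<Prod>j<d. p j ^ (if j = i then 1 else 0)) = p i" for p :: "nat \<Rightarrow> complex"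
    using i by (simp add: if_distrib[of "power _"] prod.delta cong: if_cong)
  ultimately show ?thesis
    unfolding degrees_le_def using fun_vs.span_base by simp
qed

lemma degrees_le_mult:
  assumes "degrees_le d K f" "degrees_le d L g"
  shows "degrees_le d (K + L) (\<lambda>p. f p * g p)"
proof -
  have mm: "degrees_le d (K + L) (\<lambda>p. f p * g p)" if "f \<in> monomials d K" "g \<in> monomials d L" for f g
  proof -
    obtain a b where "a \<in> {..<d} \<rightarrow>\<^sub>E {..K}" "b \<in> {..<d} \<rightarrow>\<^sub>E {..L}"
      "f = (\<lambda>p. \<Prod>i<d. p i ^ a i)" "g = (\<lambda>p. \<Prod>i<d. p i ^ b i)"
      using \<open>f \<in> _\<close> \<open>g \<in> _\<close> unfolding monomials_def by blast
    moreover from this have "(\<lambda>p. \<Prod>i<d. p i ^ (\<lambda>i. a i + b i) i) \<in> monomials d (K + L)"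
      by (intro monomial_in_monomials) (force simp: PiE_iff intro: add_mono)
    ultimately show ?thesis
      unfolding degrees_le_def
      using fun_vs.span_base by (simp add: power_add prod.distrib)
  qed
  have m: "degrees_le d (K + L) (\<lambda>p. f p * g p)" if "f \<in> monomials d K" for f
    using assms(2)[unfolded degrees_le_def]
  proof (induction rule: fun_vs.span_induct_alt)
    case base
    show ?case using degrees_le_const[of d "K + L" 0] by simp
  next
    case (step c x y)
    have "degrees_le d (K + L) (\<lambda>p. c * (f p * x p))"
      using mm[OF that step(1)] unfolding degrees_le_def by (rule fun_vs.span_scale)
    from degrees_le_add[OF this step(2)] show ?case by (simp add: algebra_simps)
  qed
  show ?thesis
    using assms(1)[unfolded degrees_le_def]
  proof (induction rule: fun_vs.span_induct_alt)
    case base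
    show ?case using degrees_le_const[of d "K + L" 0] by simp
  next
    case (step c x y)
    have "degrees_le d (K + L) (\<lambda>p. c * (x p * g p))"
      using m[OF step(1)] unfolding degrees_le_def by (rule fun_vs.span_scale)
    from degrees_le_add[OF this step(2)] show ?case by (simp add: algebra_simps)
  qed
qed

lemma degrees_le_power: "degrees_le d K f \<Longrightarrow> degrees_le d (K * n) (\<lambda>p. f p ^ n)"
proof (induction n)
  case 0
  show ?case by (simp add: degrees_le_const)
next
  case (Suc n)
  then show ?case using degrees_le_mult[of d K f "K * n"] by simp
qed

lemma degrees_le_prod:
  "finite I \<Longrightarrow> (\<And>i. i \<in> I \<Longrightarrow> degrees_le d (K i) (f i)) \<Longrightarrow>
    degrees_le d (\<Sum>i\<in>I. K i) (\<lambda>p. \<Prod>i\<in>I. f i p)"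
  by (induction I rule: finite_induct) (auto simp: degrees_le_const intro!: degrees_le_mult)

lemma mpoly_fun_degrees_le: "mpoly_fun d f \<Longrightarrow> \<exists>K. degrees_le d K f"
proof (induction rule: mpoly_fun.induct)
  case (add f g)
  then obtain K L where "degrees_le d K f" "degrees_le d L g" by blast
  then have "degrees_le d (K + L) f" "degrees_le d (K + L) g"
    by (auto elim: degrees_le_mono)
  then show ?case using degrees_le_add by blast
qed (use degrees_le_const degrees_le_var degrees_le_mult in blast)+

text \<open>Reduces nonvanishing questions in several variables to polynomials in one variable,
  which have finitely many roots.\<close>

lemma mpoly_fun_on_line:
  "mpoly_fun d f \<Longrightarrow> \<exists>r. \<forall>s. f (\<lambda>i. p i + s * (q i - p i)) = poly r s"
proof (induction rule: mpoly_fun.induct)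
  case (const c)
  show ?case by (rule exI[of _ "[:c:]"]) simp
next
  case (var i)
  show ?case by (rule exI[of _ "[:p i, q i - p i:]"]) simp
next
  case (add f g)
  then show ?case by (metis poly_add)
next
  case (mult f g)
  then show ?case by (metis poly_mult)
qed

section \<open>Rational functions with one fixed denominator\<close>

inductive ratfun :: "nat \<Rightarrow> ((nat \<Rightarrow> complex) \<Rightarrow> complex) \<Rightarrow> ((nat \<Rightarrow> complex) \<Rightarrow> complex) \<Rightarrow> bool"
  for d D where
  const: "ratfun d D (\<lambda>_. c)"
| var: "i < d \<Longrightarrow> ratfun d D (\<lambda>p. p i)"
| inv: "ratfun d D (\<lambda>p. inverse (D p))"
| add: "ratfun d D f \<Longrightarrow> ratfun d D g \<Longrightarrow> ratfun d D (\<lambda>p. f p + g p)"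
| mult: "ratfun d D f \<Longrightarrow> ratfun d D g \<Longrightarrow> ratfun d D (\<lambda>p. f p * g p)"

lemma ratfun_uminus: "ratfun d D f \<Longrightarrow> ratfun d D (\<lambda>p. - f p)"
  using ratfun.mult[OF ratfun.const[of d D "-1"]] by simp

lemma ratfun_diff: "ratfun d D f \<Longrightarrow> ratfun d D g \<Longrightarrow> ratfun d D (\<lambda>p. f p - g p)"
  using ratfun.add[OF _ ratfun_uminus] by simp

lemma ratfun_power: "ratfun d D f \<Longrightarrow> ratfun d D (\<lambda>p. f p ^ n)"
  by (induction n) (auto intro: ratfun.intros)

text \<open>These functions form the localization of the polynomials at \<open>D\<close>, so some
  power of \<open>D\<close>, depending on \<open>f\<close>, turns \<open>f\<close> into a
  polynomial.\<close>

lemma ratfun_clear_denominator: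
  assumes "ratfun d D f" and D: "mpoly_fun d D"
  shows "\<exists>N P. mpoly_fun d P \<and> (\<forall>p. D p \<noteq> 0 \<longrightarrow> D p ^ N * f p = P p)"
  using assms(1)
proof (induction rule: ratfun.induct)
  case (const c)
  show ?case by (intro exI[of _ 0] exI[of _ "\<lambda>_. c"]) (auto intro: mpoly_fun.intros)
next
  case (var i)
  then show ?case by (intro exI[of _ 0] exI[of _ "\<lambda>p. p i"]) (auto intro: mpoly_fun.intros)
next
  case inv
  show ?case by (intro exI[of _ 1] exI[of _ "\<lambda>_. 1"]) (auto intro: mpoly_fun.intros)
next
  case (add f g)
  then obtain N P M Q where "mpoly_fun d P" "\<And>p. D p \<noteq> 0 \<Longrightarrow> D p ^ N * f p = P p"
    "mpoly_fun d Q" "\<And>p. D p \<noteq> 0 \<Longrightarrow> D p ^ M * g p = Q p" by metis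
  then show ?case
    by (intro exI[of _ "N + M"] exI[of _ "\<lambda>p. D p ^ M * P p + D p ^ N * Q p"] conjI
        mpoly_fun.add mpoly_fun.mult mpoly_fun_power D allI impI)
      (simp_all flip: \<open>\<And>p. D p \<noteq> 0 \<Longrightarrow> D p ^ N * f p = P p\<close> \<open>\<And>p. D p \<noteq> 0 \<Longrightarrow> D p ^ M * g p = Q p\<close>
         add: algebra_simps power_add)
next
  case (mult f g)
  then obtain N P M Q where "mpoly_fun d P" "\<And>p. D p \<noteq> 0 \<Longrightarrow> D p ^ N * f p = P p"
    "mpoly_fun d Q" "\<And>p. D p \<noteq> 0 \<Longrightarrow> D p ^ M * g p = Q p" by metis
  then show ?case
    by (intro exI[of _ "N + M"] exI[of _ "\<lambda>p. P p * Q p"] conjI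
        mpoly_fun.mult allI impI)
      (simp_all flip: \<open>\<And>p. D p \<noteq> 0 \<Longrightarrow> D p ^ N * f p = P p\<close> \<open>\<And>p. D p \<noteq> 0 \<Longrightarrow> D p ^ M * g p = Q p\<close>
         add: algebra_simps power_add)
qed

text \<open>Only the values of \<open>\<phi>\<close> on \<open>D \<noteq> 0\<close> matter; elsewhere \<open>inverse (D p)\<close> is the junk value \<open>0\<close>.\<close>

definition rational_map ::
  "nat \<Rightarrow> ((nat \<Rightarrow> complex) \<Rightarrow> complex) \<Rightarrow> ((nat \<Rightarrow> complex) \<Rightarrow> lp_structure) \<Rightarrow> bool" where
  "rational_map d D \<phi> \<longleftrightarrow> mpoly_fun d D \<and>
     (\<forall>i j k. ratfun d D (\<lambda>p. fst (\<phi> p) (axis i 1) (axis j 1) $ k) \<and>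
              ratfun d D (\<lambda>p. snd (\<phi> p) (axis i 1) (axis j 1) $ k))"

lemma rational_map_pullback:
  assumes "rational_map d D \<phi>" "polyfun f"
  shows "\<exists>N P. mpoly_fun d P \<and> (\<forall>p. D p \<noteq> 0 \<longrightarrow> D p ^ N * f (\<phi> p) = P p)"
proof -
  have "ratfun d D (\<lambda>p. f (\<phi> p))"
    using assms(2) by (induction rule: polyfun.induct)
      (use assms(1) in \<open>auto simp: rational_map_def intro: ratfun.intros\<close>)
  then show ?thesis
    using ratfun_clear_denominator assms(1) unfolding rational_map_def by blast
qed

section \<open>Polynomial functions on structures and irreducible closed sets\<close>

lemma polyfun_sum: "(\<And>i. i \<in> I \<Longrightarrow> polyfun (f i)) \<Longrightarrow> polyfun (\<lambda>A. \<Sum>i\<in>I. f i A)"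
  by (induction I rule: infinite_finite_induct) (auto intro: polyfun.intros)

lemma polyfun_prod: "(\<And>i. i \<in> I \<Longrightarrow> polyfun (f i)) \<Longrightarrow> polyfun (\<lambda>A. \<Prod>i\<in>I. f i A)"
  by (induction I rule: infinite_finite_induct) (auto intro: polyfun.intros)

lemma polyfun_power: "polyfun f \<Longrightarrow> polyfun (\<lambda>A. f A ^ n)"
  by (induction n) (auto intro: polyfun.intros)

lemma closedin_polyfun_zeros:
  assumes "polyfun f" "X \<subseteq> Bil2"
  shows "closedin (subtopology zariski X) {A\<in>X. f A = 0}"
  unfolding closedin_subtopology closedin_zariski
  using assms by (intro exI[of _ "zero_locus {f}"]) (auto simp: zero_locus_def)

lemma closedin_separating_polyfun:
  assumes "closedin (subtopology zariski X) Z" "A \<in> X" "A \<notin> Z" "X \<subseteq> Bil2"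
  obtains f where "polyfun f" "\<And>B. B \<in> Z \<Longrightarrow> f B = 0" "f A \<noteq> 0"
proof -
  obtain F where F: "\<forall>f\<in>F. polyfun f" "Z = zero_locus F \<inter> X"
    using assms(1) unfolding closedin_subtopology closedin_zariski by blast
  then obtain f where "f \<in> F" "f A \<noteq> 0"
    using assms unfolding zero_locus_def by auto
  with F show ?thesis by (intro that[of f]) (auto simp: zero_locus_def)
qed

text \<open>If the product vanishes on \<open>Z\<close>, the zero sets of the two factors are closed
  and cover \<open>Z\<close>, so one of them is all of \<open>Z\<close>.\<close>

lemma irreducible_closedin_no_zero_divisors:
  assumes irr: "irreducible_closedin (subtopology zariski X) Z" and X: "X \<subseteq> Bil2"
    and fg: "polyfun f" "polyfun g" "\<And>A. A \<in> Z \<Longrightarrow> f A * g A = 0"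
  shows "(\<forall>A\<in>Z. f A = 0) \<or> (\<forall>A\<in>Z. g A = 0)"
proof -
  have cl: "closedin (subtopology zariski X) Z" using irr by (simp add: irreducible_closedin_def)
  have sub: "Z \<subseteq> X" using closedin_subset[OF cl] by (simp add: topspace_zariski)
  define S where "S h = Z \<inter> {A\<in>X. h A = 0}" for h :: "lp_structure \<Rightarrow> complex"
  have "closedin (subtopology zariski X) (S f)" "closedin (subtopology zariski X) (S g)"
    unfolding S_def using closedin_Int[OF cl] closedin_polyfun_zeros X fg by auto
  moreover have "Z = S f \<union> S g"
    using fg(3) sub by (auto simp: S_def)
  ultimately have "Z = S f \<or> Z = S g"
    using irr unfolding irreducible_closedin_def by blast
  then show ?thesis by (auto simp: S_def)
qed

text \<open>Induction along the chain: in a relation of least order \<open>j\<close> in \<open>f m\<close>, irreducibility of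
  \<open>Z (Suc m)\<close> cancels \<open>f m ^ j\<close>, and restricting to \<open>Z m\<close>, where \<open>f m\<close> vanishes, leaves a
  relation between the earlier functions.\<close>

lemma chain_monomials_independent:
  assumes X: "X \<subseteq> Bil2"
    and irr: "\<And>i. i \<le> n \<Longrightarrow> irreducible_closedin (subtopology zariski X) (Z i)"
    and poly: "\<And>i. i < n \<Longrightarrow> polyfun (f i)"
    and zero: "\<And>i A. i < n \<Longrightarrow> A \<in> Z i \<Longrightarrow> f i A = 0"
    and nz: "\<And>i. i < n \<Longrightarrow> \<exists>A\<in>Z (Suc i). f i A \<noteq> 0"
    and sub: "\<And>i. i < n \<Longrightarrow> Z i \<subseteq> Z (Suc i)"
  shows "m \<le> n \<Longrightarrow> (\<And>A. A \<in> Z m \<Longrightarrow> (\<Sum>a\<in>{..<m} \<rightarrow>\<^sub>E {..k}. c a * (\<Prod>i<m. f i A ^ a i)) = 0)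
    \<Longrightarrow> \<forall>a\<in>{..<m} \<rightarrow>\<^sub>E {..k}. c a = 0"
proof (induction m arbitrary: c)
  case 0
  have "Z 0 \<noteq> {}" using irr[of 0] by (simp add: irreducible_closedin_def)
  then show ?case using "0.prems"(2) by auto
next
  case (Suc m)
  let ?I = "{..<m} \<rightarrow>\<^sub>E {..k}"
  \<comment> \<open>The coefficient of \<open>f m ^ j\<close> when the relation is read as a
    polynomial in \<open>f m\<close>; \<open>a(m := j)\<close> restores the last exponent.\<close>
  define Q where "Q j A = (\<Sum>a\<in>?I. c (a(m := j)) * (\<Prod>i<m. f i A ^ a i))" for j A
  have polyQ: "polyfun (Q j)" for j
    unfolding Q_def using poly Suc.prems(1)
    by (intro polyfun_sum polyfun.mult polyfun.const polyfun_prod polyfun_power) auto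
  have S: "{..<Suc m} \<rightarrow>\<^sub>E {..k} = (\<lambda>(j, a). a(m := j)) ` ({..k} \<times> ?I)"
    by (simp add: lessThan_Suc PiE_insert_eq)
  have inj: "inj_on (\<lambda>(j, a). a(m := j)) ({..k} \<times> ?I)"
    by (intro inj_combinator) auto
  have sumQ: "(\<Sum>j\<le>k. f m A ^ j * Q j A) = 0" if "A \<in> Z (Suc m)" for A
  proof -
    have "(\<Sum>a\<in>{..<Suc m} \<rightarrow>\<^sub>E {..k}. c a * (\<Prod>i<Suc m. f i A ^ a i)) =
      (\<Sum>(j,a)\<in>{..k} \<times> ?I. c (a(m := j)) * (\<Prod>i<Suc m. f i A ^ (a(m := j)) i))"
      unfolding S sum.reindex[OF inj] by (simp add: case_prod_unfold)
    also have "\<dots> = (\<Sum>j\<le>k. \<Sum>a\<in>?I. f m A ^ j * (c (a(m := j)) * (\<Prod>i<m. f i A ^ a i)))"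
      unfolding sum.cartesian_product[symmetric]
      by (intro sum.cong refl) (simp add: mult_ac)
    also have "\<dots> = (\<Sum>j\<le>k. f m A ^ j * Q j A)"
      by (simp add: Q_def sum_distrib_left)
    finally show ?thesis using Suc.prems(2)[OF that] by simp
  qed
  have "j \<le> k \<longrightarrow> (\<forall>a\<in>?I. c (a(m := j)) = 0)" for j
  proof (induction j rule: less_induct)
    case (less j)
    show ?case
    proof
      assume j: "j \<le> k"
      have lt: "Q i A = 0" if "i < j" for i A
        unfolding Q_def using less that j by (intro sum.neutral) (auto simp del: fun_upd_apply)
      \<comment> \<open>What remains of the terms above \<open>j\<close> after division by
        \<open>f m ^ Suc j\<close>. Cancelling only \<open>f m ^ j\<close> leaves one factor
        \<open>f m\<close> in front of \<open>R\<close>, and this factor vanishes on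
        \<open>Z m\<close>.\<close>
      define R where "R A = (\<Sum>i\<in>{j<..k}. f m A ^ (i - Suc j) * Q i A)" for A
      have polyR: "polyfun R"
        unfolding R_def using poly Suc.prems(1) polyQ
        by (intro polyfun_sum polyfun.mult polyfun_power) auto
      have eq: "(\<Sum>i\<le>k. f m A ^ i * Q i A) = f m A ^ j * (Q j A + f m A * R A)" for A
      proof -
        have "(\<Sum>i\<le>k. f m A ^ i * Q i A) = (\<Sum>i\<in>insert j {j<..k}. f m A ^ i * Q i A)"
        proof (rule sum.mono_neutral_right)
          show "\<forall>i\<in>{..k} - insert j {j<..k}. f m A ^ i * Q i A = 0"
          proof
            fix i assume "i \<in> {..k} - insert j {j<..k}"
            then have "i < j" by auto
            then show "f m A ^ i * Q i A = 0" by (simp add: lt)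
          qed
        qed (use j in auto)
        also have "\<dots> = f m A ^ j * Q j A + (\<Sum>i\<in>{j<..k}. f m A ^ i * Q i A)"
          by simp
        also have "(\<Sum>i\<in>{j<..k}. f m A ^ i * Q i A) = f m A ^ j * (f m A * R A)"
          unfolding R_def sum_distrib_left
        proof (intro sum.cong refl)
          fix i assume "i \<in> {j<..k}"
          then have "f m A ^ i = f m A ^ j * (f m A * f m A ^ (i - Suc j))"
            by (simp flip: power_Suc power_add)
          then show "f m A ^ i * Q i A = f m A ^ j * (f m A * (f m A ^ (i - Suc j) * Q i A))"
            by (simp add: mult.assoc)
        qed
        finally show ?thesis by (simp add: algebra_simps)
      qed
      have "(\<forall>A\<in>Z (Suc m). f m A ^ j = 0) \<or> (\<forall>A\<in>Z (Suc m). Q j A + f m A * R A = 0)"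
        using Suc.prems(1) poly polyQ polyR sumQ eq
        by (intro irreducible_closedin_no_zero_divisors[OF irr X] polyfun_power
            polyfun.add polyfun.mult) (auto simp: mult.commute)
      then have "\<forall>A\<in>Z (Suc m). Q j A + f m A * R A = 0"
        using nz[of m] Suc.prems(1) by auto
      then have "\<forall>A\<in>Z m. Q j A = 0"
        using sub[of m] zero[of m] Suc.prems(1) by fastforce
      then show "\<forall>a\<in>?I. c (a(m := j)) = 0"
        using Suc.IH[of "\<lambda>a. c (a(m := j))"] Suc.prems(1) by (simp add: Q_def)
    qed
  qed
  then show ?case unfolding S by auto
qed

section \<open>Upper and lower bounds for the Krull dimension\<close>

lemma polynomial_growth_exponent:
  assumes "\<And>k. (k + 1) ^ n \<le> (k * C + 1 :: nat) ^ d"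
  shows "n \<le> d"
proof (rule ccontr)
  assume "\<not> n \<le> d"
  \<comment> \<open>Chosen so that \<open>((C + 1) * (k + 1)) ^ d\<close> equals
    \<open>k * (k + 1) ^ d\<close>, which is just below \<open>(k + 1) ^ Suc d\<close>.\<close>
  define k where "k = (C + 1) ^ d"
  have "(k + 1) * (k + 1) ^ d = (k + 1) ^ Suc d" by simp
  also have "\<dots> \<le> (k + 1) ^ n" using \<open>\<not> n \<le> d\<close> by (intro power_increasing) auto
  also have "\<dots> \<le> (k * C + 1) ^ d" by (rule assms)
  also have "\<dots> \<le> ((C + 1) * (k + 1)) ^ d" by (intro power_mono) auto
  also have "\<dots> = k * (k + 1) ^ d" by (simp only: k_def power_mult_distrib)
  finally show False by simp
qed

text \<open>As \<open>\<phi>\<close> covers \<open>X\<close>, a function on \<open>X\<close> is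
  determined by its pullback, so a relation between the pulled-back monomials is a relation on
  \<open>X\<close>; the fibres of \<open>\<phi>\<close> may be of any size.\<close>

theorem krull_dim_le_rational_image:
  assumes rat: "rational_map d D \<phi>" and X: "X \<subseteq> Bil2" "X \<subseteq> \<phi> ` {p. D p \<noteq> 0}"
  shows "krull_dim (subtopology zariski X) \<le> enat d"
  unfolding krull_dim_def
proof (rule Sup_least, clarify)
  fix n Z
  assume irr: "\<forall>i\<le>n. irreducible_closedin (subtopology zariski X) (Z i)"
    and strict: "\<forall>i<n. Z i \<subset> Z (Suc i)"
  have cl: "closedin (subtopology zariski X) (Z i)" and subX: "Z i \<subseteq> X" if "i \<le> n" for i
    using irr that closedin_subset by (fastforce simp: irreducible_closedin_def topspace_zariski)+
  have "\<exists>f. polyfun f \<and> (\<forall>A\<in>Z i. f A = 0) \<and> (\<exists>A\<in>Z (Suc i). f A \<noteq> 0)" if i: "i < n" for i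
  proof -
    obtain A where A: "A \<in> Z (Suc i)" "A \<notin> Z i" using strict i by blast
    have "A \<in> X" using subX[of "Suc i"] A i by auto
    then show ?thesis
      using closedin_separating_polyfun[OF cl[of i] _ A(2) X(1)] A i by (metis less_imp_le)
  qed
  then obtain f where f: "\<And>i. i < n \<Longrightarrow> polyfun (f i)" "\<And>i A. i < n \<Longrightarrow> A \<in> Z i \<Longrightarrow> f i A = 0"
    "\<And>i. i < n \<Longrightarrow> \<exists>A\<in>Z (Suc i). f i A \<noteq> 0" by metis
  have ind: "\<forall>a\<in>{..<n} \<rightarrow>\<^sub>E {..k}. c a = 0"
    if "\<And>A. A \<in> X \<Longrightarrow> (\<Sum>a\<in>{..<n} \<rightarrow>\<^sub>E {..k}. c a * (\<Prod>i<n. f i A ^ a i)) = 0" for k c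
  proof (rule chain_monomials_independent[OF X(1), of n Z f n])
    show "(\<Sum>a\<in>{..<n} \<rightarrow>\<^sub>E {..k}. c a * (\<Prod>i<n. f i A ^ a i)) = 0" if "A \<in> Z n" for A
      using \<open>\<And>A. A \<in> X \<Longrightarrow> _\<close> subX[of n] that by blast
  qed (use irr f strict in auto)
  have "\<exists>N P K. (\<forall>p. D p \<noteq> 0 \<longrightarrow> D p ^ N * f i (\<phi> p) = P p) \<and> degrees_le d K P" if "i < n" for i
    using rational_map_pullback[OF rat f(1)[OF that]] mpoly_fun_degrees_le by metis
  then obtain N P K where P: "\<And>i p. i < n \<Longrightarrow> D p \<noteq> 0 \<Longrightarrow> D p ^ N i * f i (\<phi> p) = P i p"
    and K: "\<And>i. i < n \<Longrightarrow> degrees_le d (K i) (P i)" by metis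
  obtain L where L: "degrees_le d L D"
    using rat mpoly_fun_degrees_le unfolding rational_map_def by blast
  \<comment> \<open>Independent of \<open>k\<close>: clearing the denominators of a monomial with
    exponents up to \<open>k\<close> costs degree at most \<open>k * C\<close>.\<close>
  define C where "C = (\<Sum>i<n. K i + L * N i)"
  have "(k + 1) ^ n \<le> (k * C + 1) ^ d" for k
  proof -
    let ?I = "{..<n} \<rightarrow>\<^sub>E {..k}"
    \<comment> \<open>The exponents \<open>N i * (k - a i)\<close> pad the denominators, so that
      every pulled-back monomial is multiplied by the same power of \<open>D\<close> and linear
      relations are preserved.\<close>
    define M where "M a p = (\<Prod>i<n. P i p ^ a i * D p ^ (N i * (k - a i)))" for a :: "nat \<Rightarrow> nat" and p
    have deg: "degrees_le d (k * C) (M a)" if "a \<in> ?I" for a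
    proof -
      have "degrees_le d (\<Sum>i<n. K i * a i + L * (N i * (k - a i))) (M a)"
        unfolding M_def by (intro degrees_le_prod degrees_le_mult degrees_le_power K L) auto
      moreover have "(\<Sum>i<n. K i * a i + L * (N i * (k - a i))) \<le> (\<Sum>i<n. k * (K i + L * N i))"
      proof (rule sum_mono)
        fix i assume "i \<in> {..<n}"
        then have "a i \<le> k" using that by (auto simp: PiE_iff)
        then have "K i * a i \<le> K i * k" "L * (N i * (k - a i)) \<le> L * (N i * k)" by simp_all
        then have "K i * a i + L * (N i * (k - a i)) \<le> K i * k + L * (N i * k)" by (rule add_mono)
        also have "\<dots> = k * (K i + L * N i)" by (simp add: algebra_simps)
        finally show "K i * a i + L * (N i * (k - a i)) \<le> k * (K i + L * N i)" .
      qed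
      ultimately show ?thesis
        unfolding C_def sum_distrib_left by (rule degrees_le_mono)
    qed
    have M: "M a p = D p ^ (\<Sum>i<n. N i * k) * (\<Prod>i<n. f i (\<phi> p) ^ a i)"
      if "a \<in> ?I" "D p \<noteq> 0" for a p
    proof -
      have "M a p = (\<Prod>i<n. D p ^ (N i * k) * f i (\<phi> p) ^ a i)"
        unfolding M_def
      proof (intro prod.cong refl)
        fix i assume "i \<in> {..<n}"
        then have "a i \<le> k" "P i p = D p ^ N i * f i (\<phi> p)" using that P by (auto simp: PiE_iff)
        moreover have "D p ^ (N i * a i) * D p ^ (N i * (k - a i)) = D p ^ (N i * k)"
          using \<open>a i \<le> k\<close> by (simp flip: power_add add_mult_distrib2)
        ultimately show "P i p ^ a i * D p ^ (N i * (k - a i)) = D p ^ (N i * k) * f i (\<phi> p) ^ a i"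
          by (simp add: power_mult_distrib flip: power_mult)
      qed
      then show ?thesis by (simp add: prod.distrib power_sum)
    qed
    have "card ?I \<le> card (monomials d (k * C))"
    proof (rule card_le_of_independent_family[of _ _ M])
      show "finite ?I" by (intro finite_PiE) auto
      show "finite (monomials d (k * C))" by (rule finite_monomials)
      show "M a \<in> fun_vs.span (monomials d (k * C))" if "a \<in> ?I" for a
        using deg[OF that] by (simp add: degrees_le_def)
      fix c assume c: "\<And>p. (\<Sum>a\<in>?I. c a * M a p) = 0"
      show "\<forall>a\<in>?I. c a = 0"
      proof (rule ind)
        fix A assume "A \<in> X"
        then obtain p where p: "D p \<noteq> 0" "A = \<phi> p" using X(2) by blast
        have "(\<Sum>a\<in>?I. c a * M a p) = D p ^ (\<Sum>i<n. N i * k) * (\<Sum>a\<in>?I. c a * (\<Prod>i<n. f i A ^ a i))"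
          unfolding sum_distrib_left by (intro sum.cong refl) (simp add: M p)
        then show "(\<Sum>a\<in>?I. c a * (\<Prod>i<n. f i A ^ a i)) = 0"
          using c p by simp
      qed
    qed
    also have "\<dots> \<le> (k * C + 1) ^ d" by (rule card_monomials)
    finally show ?thesis by (simp add: card_PiE)
  qed
  then have "n \<le> d" by (rule polynomial_growth_exponent)
  then show "enat n \<le> enat d" by simp
qed

text \<open>Parameters are released one after the other from the base point \<open>c\<close>. The
  function given by \<open>sep\<close> vanishes as long as parameter \<open>i\<close> is frozen and
  detects its release, which makes the chain of closures strict.\<close>

theorem krull_dim_ge_rational_image:
  assumes rat: "rational_map d D \<phi>" and X: "X \<subseteq> Bil2" "\<phi> ` {p. D p \<noteq> 0} \<subseteq> X"
    and c: "D c \<noteq> 0"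
    and sep: "\<And>i. i < d \<Longrightarrow> \<exists>f. polyfun f \<and>
      (\<forall>p. D p \<noteq> 0 \<longrightarrow> (\<forall>j\<ge>i. p j = c j) \<longrightarrow> f (\<phi> p) = 0) \<and>
      (\<exists>p. D p \<noteq> 0 \<and> (\<forall>j>i. p j = c j) \<and> f (\<phi> p) \<noteq> 0)"
  shows "enat d \<le> krull_dim (subtopology zariski X)"
proof -
  \<comment> \<open>\<open>U 0\<close> is the single point \<open>c\<close>, and passing to
    \<open>U (Suc i)\<close> frees parameter \<open>i\<close>; the chain from \<open>U 0\<close> to
    \<open>U d\<close> therefore has \<open>d\<close> steps.\<close>
  define U where "U i = {p. D p \<noteq> 0 \<and> (\<forall>j\<ge>i. p j = c j)}" for i
  let ?T = "subtopology zariski X"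
  define Z where "Z i = ?T closure_of (\<phi> ` U i)" for i
  have top: "topspace ?T = X" using X by (auto simp: topspace_zariski)
  have UX: "\<phi> ` U i \<subseteq> X" for i using X(2) by (auto simp: U_def)
  have UZ: "\<phi> ` U i \<subseteq> Z i" for i
    unfolding Z_def by (rule closure_of_subset) (use top UX in simp)
  have clZ: "closedin ?T (Z i)" for i unfolding Z_def by simp
  have no_zero_div: "\<exists>p\<in>U i. f (\<phi> p) * g (\<phi> p) \<noteq> 0"
    if fg: "polyfun f" "polyfun g" and pq: "p \<in> U i" "q \<in> U i" "f (\<phi> p) \<noteq> 0" "g (\<phi> q) \<noteq> 0"
    for f g p q i
  proof -
    obtain N P M Q where P: "mpoly_fun d P" "\<And>p. D p \<noteq> 0 \<Longrightarrow> D p ^ N * f (\<phi> p) = P p"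
      and Q: "mpoly_fun d Q" "\<And>p. D p \<noteq> 0 \<Longrightarrow> D p ^ M * g (\<phi> p) = Q p"
      using rational_map_pullback[OF rat fg(1)] rational_map_pullback[OF rat fg(2)] by blast
    \<comment> \<open>The line stays within the affine subspace of frozen parameters. Along it the
      cleared forms of \<open>f\<close> and \<open>g\<close> and the denominator are polynomials in
      \<open>s\<close>, nonzero at 0, 1 and 0 respectively, so some \<open>s\<close> is a root of
      none of them.\<close>
    define l where "l s i = p i + s * (q i - p i)" for s and i
    obtain a where a: "\<And>s. P (l s) = poly a s"
      using mpoly_fun_on_line[OF P(1), of p q] unfolding l_def by blast
    obtain b where b: "\<And>s. Q (l s) = poly b s"
      using mpoly_fun_on_line[OF Q(1), of p q] unfolding l_def by blast
    obtain e where e: "\<And>s. D (l s) = poly e s"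
      using mpoly_fun_on_line[of d D p q] rat unfolding l_def rational_map_def by blast
    have "l 0 = p" "l 1 = q" by (auto simp: l_def)
    then have "poly a 0 \<noteq> 0" "poly b 1 \<noteq> 0" "poly e 0 \<noteq> 0"
      using pq a[of 0] b[of 1] e[of 0] P(2)[of p] Q(2)[of q] by (auto simp: U_def)
    then have "a * b * e \<noteq> 0" by auto
    then have "finite {s. poly (a * b * e) s = 0}" by (rule poly_roots_finite)
    then obtain s where "poly (a * b * e) s \<noteq> 0"
      using ex_new_if_finite[OF infinite_UNIV_char_0] by blast
    then have s: "P (l s) \<noteq> 0" "Q (l s) \<noteq> 0" "D (l s) \<noteq> 0" using a b e by auto
    then have "l s \<in> U i" using pq by (auto simp: U_def l_def)
    moreover have "f (\<phi> (l s)) \<noteq> 0" "g (\<phi> (l s)) \<noteq> 0" using s P(2)[of "l s"] Q(2)[of "l s"] by auto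
    ultimately show ?thesis by auto
  qed
  have irr: "irreducible_closedin ?T (Z i)" for i
    unfolding irreducible_closedin_def
  proof (intro conjI allI impI clZ)
    have "c \<in> U i" using c by (simp add: U_def)
    then show "Z i \<noteq> {}" using UZ by blast
    fix A B assume AB: "closedin ?T A \<and> closedin ?T B \<and> Z i = A \<union> B"
    \<comment> \<open>A closed set that does not contain the closure already misses a parametrized
      point, where polynomials can be pulled back.\<close>
    have "\<exists>f p. polyfun f \<and> (\<forall>S\<in>A. f S = 0) \<and> p \<in> U i \<and> f (\<phi> p) \<noteq> 0"
      if A: "closedin ?T A" "\<not> Z i \<subseteq> A" for A
    proof -
      have "\<not> \<phi> ` U i \<subseteq> A"
        using A closure_of_minimal[of "\<phi> ` U i" A] unfolding Z_def by blast
      then obtain p where p: "p \<in> U i" "\<phi> p \<notin> A" by blast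
      then have "\<phi> p \<in> X" using UX by blast
      then obtain f where "polyfun f" "\<And>S. S \<in> A \<Longrightarrow> f S = 0" "f (\<phi> p) \<noteq> 0"
        using closedin_separating_polyfun[OF A(1) _ p(2) X(1)] by blast
      then show ?thesis using p(1) by blast
    qed
    note avoid = this
    show "Z i = A \<or> Z i = B"
    proof (rule ccontr)
      assume "\<not> (Z i = A \<or> Z i = B)"
      then have "\<not> Z i \<subseteq> A" "\<not> Z i \<subseteq> B" using AB by auto
      moreover have cl: "closedin ?T A" "closedin ?T B" using AB by simp_all
      ultimately obtain f p g q where
        f: "polyfun f" "\<forall>S\<in>A. f S = 0" "p \<in> U i" "f (\<phi> p) \<noteq> 0" and
        g: "polyfun g" "\<forall>S\<in>B. g S = 0" "q \<in> U i" "g (\<phi> q) \<noteq> 0"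
        using avoid[OF cl(1)] avoid[OF cl(2)] by metis
      obtain r where r: "r \<in> U i" "f (\<phi> r) * g (\<phi> r) \<noteq> 0"
        using no_zero_div[OF f(1) g(1) f(3) g(3) f(4) g(4)] by blast
      then have "\<phi> r \<in> A \<union> B" using UZ[of i] AB by blast
      then show False using f(2) g(2) r(2) by auto
    qed
  qed
  have "Z i \<subset> Z (Suc i)" if i: "i < d" for i
  proof -
    obtain f where f: "polyfun f" "\<And>p. p \<in> U i \<Longrightarrow> f (\<phi> p) = 0" "\<exists>p\<in>U (Suc i). f (\<phi> p) \<noteq> 0"
      using sep[OF i] unfolding U_def Suc_le_eq by blast
    have "Z i \<subseteq> {A\<in>X. f A = 0}"
      unfolding Z_def using closedin_polyfun_zeros[OF f(1) X(1)] UX f(2)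
      by (intro closure_of_minimal) auto
    moreover have "Z i \<subseteq> Z (Suc i)"
      unfolding Z_def by (intro closure_of_mono image_mono) (auto simp: U_def)
    ultimately show ?thesis using f(3) UZ[of "Suc i"] by blast
  qed
  then show ?thesis
    unfolding krull_dim_def using irr by (intro Sup_upper) auto
qed

text \<open>One formula serves both bounds, with two denominators: the domain of \<open>D\<close>
  must reach all of \<open>X\<close>, while the domain of \<open>D'\<close> must not leave
  \<open>X\<close>. The two demands can conflict for a single denominator.\<close>

lemma krull_dim_eqI:
  assumes "rational_map d D \<phi>" "rational_map d D' \<phi>" "X \<subseteq> Bil2" "X \<subseteq> \<phi> ` {p. D p \<noteq> 0}"
    "\<phi> ` {p. D' p \<noteq> 0} \<subseteq> X" "D' c \<noteq> 0"
    "\<And>i. i < d \<Longrightarrow> \<exists>f p. polyfun f \<and>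
      (\<forall>q. D' q \<noteq> 0 \<longrightarrow> (\<forall>j\<ge>i. q j = c j) \<longrightarrow> f (\<phi> q) = 0) \<and>
      D' p \<noteq> 0 \<and> (\<forall>j>i. p j = c j) \<and> f (\<phi> p) \<noteq> 0"
  shows "krull_dim (subtopology zariski X) = enat d"
proof (rule antisym)
  show "krull_dim (subtopology zariski X) \<le> enat d"
    by (rule krull_dim_le_rational_image[OF assms(1,3,4)])
  show "enat d \<le> krull_dim (subtopology zariski X)"
  proof (rule krull_dim_ge_rational_image[OF assms(2,3,5,6)])
    fix i assume "i < d"
    from assms(7)[OF this] show "\<exists>f. polyfun f \<and>
      (\<forall>p. D' p \<noteq> 0 \<longrightarrow> (\<forall>j\<ge>i. p j = c j) \<longrightarrow> f (\<phi> p) = 0) \<and>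
      (\<exists>p. D' p \<noteq> 0 \<and> (\<forall>j>i. p j = c j) \<and> f (\<phi> p) \<noteq> 0)"
      by blast
  qed
qed

lemma mpoly_fun_diff: "mpoly_fun d f \<Longrightarrow> mpoly_fun d g \<Longrightarrow> mpoly_fun d (\<lambda>p. f p - g p)"
  using mpoly_fun.add[OF _ mpoly_fun.mult[OF mpoly_fun.const[of d "-1"]], of f g] by simp

lemma polyfun_minus_const: "polyfun f \<Longrightarrow> polyfun (\<lambda>A. f A - k)"
  using polyfun.add[OF _ polyfun.const[of "- k"], of f] by simp

section \<open>Orbits\<close>

definition lin :: "complex \<Rightarrow> complex \<Rightarrow> complex \<Rightarrow> complex \<Rightarrow> V \<Rightarrow> V" where
  "lin a b c d x = vector [a * x $ 1 + b * x $ 2, c * x $ 1 + d * x $ 2]"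

lemma lin_nth: "lin a b c d x $ 1 = a * x $ 1 + b * x $ 2" "lin a b c d x $ 2 = c * x $ 1 + d * x $ 2"
  by (simp_all add: lin_def)

lemma axis_nth_2: "e1 $ 1 = 1" "e1 $ 2 = 0" "e2 $ 1 = 0" "e2 $ 2 = 1"
  by (simp_all add: axis_def)

lemma linear_lin: "Vector_Spaces.linear (*s) (*s) (lin a b c d)"
  by unfold_locales (simp_all add: vec_eq_iff forall_2 lin_nth algebra_simps)

lemma linear_eq_lin:
  assumes "Vector_Spaces.linear (*s) (*s) (g :: V \<Rightarrow> V)"
  shows "g = lin (g e1 $ 1) (g e2 $ 1) (g e1 $ 2) (g e2 $ 2)"
proof
  fix x :: V
  interpret g: Vector_Spaces.linear "(*s)" "(*s)" g by (rule assms)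
  have "x = x $ 1 *s e1 + x $ 2 *s e2"
    by (simp add: vec_eq_iff forall_2 axis_nth_2)
  then have "g x = x $ 1 *s g e1 + x $ 2 *s g e2"
    by (metis g.add g.scale)
  then show "g x = lin (g e1 $ 1) (g e2 $ 1) (g e1 $ 2) (g e2 $ 2) x"
    by (simp add: vec_eq_iff forall_2 lin_nth algebra_simps)
qed

lemma lin_inverse:
  assumes "a * d - b * c \<noteq> 0" "e = inverse (a * d - b * c)"
  shows "lin (d * e) (- b * e) (- c * e) (a * e) (lin a b c d x) = x"
    "lin a b c d (lin (d * e) (- b * e) (- c * e) (a * e) x) = x"
proof -
  have "(a * d - b * c) * e = 1" using assms by simp
  then have "a * d * e = 1 + b * c * e" by (simp add: algebra_simps)
  then have ade: "a * d * e * t = (1 + b * c * e) * t" for t by simp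
  have e: "a * (d * (e * t)) = t + b * (c * (e * t))" for t
    using ade[of t] by (simp add: algebra_simps)
  show "lin (d * e) (- b * e) (- c * e) (a * e) (lin a b c d x) = x"
    "lin a b c d (lin (d * e) (- b * e) (- c * e) (a * e) x) = x"
    by (simp_all add: vec_eq_iff forall_2 lin_nth algebra_simps e)
qed

lemma bij_lin_iff: "bij (lin a b c d) \<longleftrightarrow> a * d - b * c \<noteq> 0"
proof
  assume bij: "bij (lin a b c d)"
  show "a * d - b * c \<noteq> 0"
  proof
    assume z: "a * d - b * c = 0"
    \<comment> \<open>The columns of the adjugate matrix lie in the kernel when the determinant is
      zero; injectivity then makes every entry zero.\<close>
    have "lin a b c d (vector [d, - c]) = lin a b c d 0" "lin a b c d (vector [- b, a]) = lin a b c d 0"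
      using z by (simp_all add: vec_eq_iff forall_2 lin_nth algebra_simps)
    then have "vector [d, - c] = (0 :: V)" "vector [- b, a] = (0 :: V)"
      using bij_is_inj[OF bij] by (meson injD)+
    then have "a = 0" "b = 0" "c = 0" "d = 0" by (simp_all add: vec_eq_iff forall_2)
    then have "lin a b c d e1 = lin a b c d 0" by (simp add: vec_eq_iff forall_2 lin_nth)
    then have "e1 = (0 :: V)" using bij_is_inj[OF bij] by (meson injD)
    then show False by (simp add: vec_eq_iff forall_2 axis_nth_2)
  qed
next
  assume nz: "a * d - b * c \<noteq> 0"
  show "bij (lin a b c d)"
    by (rule o_bij[where g = "lin (d * inverse (a * d - b * c)) (- b * inverse (a * d - b * c))
          (- c * inverse (a * d - b * c)) (a * inverse (a * d - b * c))"])
      (simp_all only: fun_eq_iff comp_apply id_apply lin_inverse[OF nz refl] simp_thms)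
qed

lemma GL_eq: "GL = {lin a b c d | a b c d. a * d - b * c \<noteq> 0}"
proof (intro set_eqI iffI)
  fix g :: "V \<Rightarrow> V" assume g: "g \<in> GL"
  then have "g = lin (g e1 $ 1) (g e2 $ 1) (g e1 $ 2) (g e2 $ 2)" "bij g"
    unfolding GL_def using linear_eq_lin by blast+
  then show "g \<in> {lin a b c d | a b c d. a * d - b * c \<noteq> 0}"
    using bij_lin_iff by (metis (mono_tags, lifting) mem_Collect_eq)
qed (auto simp: GL_def linear_lin bij_lin_iff)

lemma act_eqI:
  assumes "g \<in> GL" "\<And>x y. g (fst A x y) = fst B (g x) (g y)" "\<And>x y. g (snd A x y) = snd B (g x) (g y)"
  shows "act g A = B"
proof -
  have "g (inv g x) = x" for x
    using assms(1) by (simp add: GL_def bij_is_surj surj_f_inv_f)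
  then show ?thesis by (simp add: act_def assms prod_eq_iff)
qed

lemma act_equivariant:
  assumes "g \<in> GL"
  shows "g (fst A x y) = fst (act g A) (g x) (g y)" "g (snd A x y) = snd (act g A) (g x) (g y)"
  using assms by (simp_all add: act_def GL_def bij_is_inj)

lemma cbilinear_eq_bil:
  assumes "cbilinear m"
  shows "m = bil (m e1 e1) (m e1 e2) (m e2 e1) (m e2 e2)"
proof (intro ext)
  fix x y :: V
  have dec: "z = z $ 1 *s e1 + z $ 2 *s e2" for z :: V
    by (simp add: vec_eq_iff forall_2 axis_nth_2)
  have hom: "module_hom (*s) (*s) (m x)" "module_hom (*s) (*s) (\<lambda>x. m x y)" for x y
    using assms unfolding cbilinear_def linear_iff_module_hom by auto
  note l = module_hom.add[OF hom(1)] module_hom.scale[OF hom(1)]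
    module_hom.add[OF hom(2)] module_hom.scale[OF hom(2)]
  show "m x y = bil (m e1 e1) (m e1 e2) (m e2 e1) (m e2 e2) x y"
    by (subst dec[of x], subst dec[of y])
      (simp only: l bil_def vec_eq_iff, simp add: algebra_simps)
qed

lemma GL_orbit_eq: "GL_orbit A = {act (lin a b c d) A | a b c d. a * d - b * c \<noteq> 0}"
  unfolding GL_orbit_def GL_eq by blast

lemma GL_orbit_subset_Bil2: "GL_orbit (bil A11 A12 A21 A22, bil A'11 A'12 A'21 A'22) \<subseteq> Bil2"
proof
  let ?A = "(bil A11 A12 A21 A22, bil A'11 A'12 A'21 A'22)"
  fix S assume "S \<in> GL_orbit ?A"
  then obtain a b c d where nz: "a * d - b * c \<noteq> 0" and S: "S = act (lin a b c d) ?A"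
    unfolding GL_orbit_eq by blast
  define e where "e = inverse (a * d - b * c)"
  define g where "g = lin a b c d"
  define h where "h = lin (d * e) (- b * e) (- c * e) (a * e)"
  have hg: "inv g = h"
  proof (rule inv_equality)
    show "h (g x) = x" "g (h x) = x" for x
      unfolding g_def h_def by (rule lin_inverse[OF nz e_def])+
  qed
  have comp: "Vector_Spaces.linear (*s) (*s) (\<lambda>x. g (k (h x)))"
    "Vector_Spaces.linear (*s) (*s) (\<lambda>x. g (k x))"
    if "Vector_Spaces.linear (*s) (*s) k" for k :: "V \<Rightarrow> V"
    using Vector_Spaces.linear_compose[OF Vector_Spaces.linear_compose[OF linear_lin that] linear_lin]
      Vector_Spaces.linear_compose[OF that linear_lin]
    unfolding g_def h_def comp_def by blast+
  have "cbilinear (\<lambda>x y. g (m (h x) (h y)))" if "cbilinear m" for m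
    using that comp(2)[of "m (h x)" for x] comp(1)[of "\<lambda>x. m x (h y)" for y] comp(1)[of "m x" for x]
    unfolding cbilinear_def by blast
  then show "S \<in> Bil2"
    unfolding S act_def g_def[symmetric] hg by (simp add: Bil2_def cbilinear_bil)
qed

text \<open>The polynomial map \<open>t \<mapsto> (t\<^sup>2 - 1, t)\<close> never vanishes and meets every line through the origin, so
  a single affine chart parametrizes the projective line.\<close>

lemma direction_cover:
  fixes x y :: complex
  assumes "x \<noteq> 0 \<or> y \<noteq> 0"
  obtains s t where "s \<noteq> 0" "x = s * (t ^ 2 - 1)" "y = s * t"
proof (cases "y = 0")
  case True
  then show ?thesis using assms that[of "- x" 0] by simp
next
  case False
  \<comment> \<open>The vectors \<open>(x, y)\<close> and \<open>(t^2 - 1, t)\<close> are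
    proportional iff \<open>y * t^2 - x * t - y = 0\<close>, and this is a root. It is nonzero
    because the constant term is \<open>- y\<close>, so \<open>y / t\<close> is the scaling
    factor.\<close>
  define t where "t = (x + csqrt (x ^ 2 + 4 * y ^ 2)) / (2 * y)"
  have "2 * y * t - x = csqrt (x ^ 2 + 4 * y ^ 2)"
    using False by (simp add: t_def)
  then have "(2 * y * t - x) ^ 2 = x ^ 2 + 4 * y ^ 2"
    by simp
  then have "4 * y * (y * (t ^ 2 - 1) - x * t) = 0" by algebra
  then have t: "y * (t ^ 2 - 1) = x * t" using False by simp
  then have "t \<noteq> 0" using False by auto
  then show ?thesis
    using that[of "y / t" t] False t by (simp add: field_simps)
qed

section \<open>Parametrizations of the orbits by forms and vectors\<close>

definition dot :: "V \<Rightarrow> V \<Rightarrow> complex" where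
  "dot f x = f $ 1 * x $ 1 + f $ 2 * x $ 2"

text \<open>\<open>dot\<close> is bilinear, without conjugation, and its first argument stands for a
  linear form. \<open>dot (perp x) y\<close> is the determinant with columns \<open>x\<close> and
  \<open>y\<close>, and \<open>perp h\<close> lies in the kernel of the form
  \<open>h\<close>.\<close>

definition perp :: "V \<Rightarrow> V" where
  "perp v = vector [- v $ 2, v $ 1]"

lemma perp_nth: "perp v $ 1 = - v $ 2" "perp v $ 2 = v $ 1"
  by (simp_all add: perp_def)

lemma dual_basis:
  assumes "a * d - b * c \<noteq> 0" "f = vector [d / (a * d - b * c), - b / (a * d - b * c)]"
    "h = vector [- c / (a * d - b * c), a / (a * d - b * c)]"
  shows "dot f (lin a b c d x) = x $ 1" "dot h (lin a b c d x) = x $ 2"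
  unfolding assms(2,3) dot_def lin_def vector_2 using assms(1)
  by (simp_all add: divide_simps) (simp_all add: algebra_simps)

text \<open>Both \<open>L5 \<beta>\<close> (with \<open>\<kappa> = 1\<close>, \<open>l = -1\<close>) and \<open>L6 \<beta>\<close> (with \<open>\<kappa> = 0\<close>, \<open>l = 1\<close>) are instances, with
  \<open>f\<close> the first coordinate and \<open>u = e1\<close>.\<close>

definition unital_family :: "complex \<Rightarrow> complex \<Rightarrow> complex \<Rightarrow> V \<Rightarrow> V \<Rightarrow> lp_structure" where
  "unital_family \<kappa> l \<beta> f u =
     ((\<lambda>x y. (\<kappa> * dot f x) *s y + (\<kappa> * dot f y) *s x + (l * dot f x * dot f y) *s u),
      (\<lambda>x y. (\<beta> * dot f y) *s x - (\<beta> * dot f x * dot f y) *s u))"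

lemma act_lin_unital_family:
  assumes "a * d - b * c \<noteq> 0" "\<And>x. dot f (lin a b c d x) = x $ 1" "u = vector [a, c]"
  shows "act (lin a b c d) (bil ((2 * \<kappa> + l) *s e1) (\<kappa> *s e2) (\<kappa> *s e2) 0, bil 0 0 (\<beta> *s e2) 0) =
    unital_family \<kappa> l \<beta> f u"
proof (rule act_eqI)
  show "lin a b c d \<in> GL" using assms(1) by (auto simp: GL_eq)
qed (simp_all add: unital_family_def assms(2,3) vec_eq_iff forall_2 lin_nth bil_nth axis_nth_2 algebra_simps)

text \<open>The transported structure remembers only the first column \<open>u\<close> of the matrix
  and the first row \<open>f\<close> of its inverse: four numbers bound by one equation.\<close>

lemma orbit_unital_family:
  "GL_orbit (bil ((2 * \<kappa> + l) *s e1) (\<kappa> *s e2) (\<kappa> *s e2) 0, bil 0 0 (\<beta> *s e2) 0) =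
    {unital_family \<kappa> l \<beta> f u | f u. dot f u = 1}"
  (is "GL_orbit ?A = ?R")
proof (intro set_eqI iffI)
  fix S assume "S \<in> GL_orbit ?A"
  then obtain a b c d where nz: "a * d - b * c \<noteq> 0" and S: "S = act (lin a b c d) ?A"
    unfolding GL_orbit_eq by blast
  define f :: V where "f = vector [d / (a * d - b * c), - b / (a * d - b * c)]"
  have f: "dot f (lin a b c d x) = x $ 1" for x
    by (rule dual_basis(1)[OF nz f_def refl])
  have "lin a b c d e1 = vector [a, c]" by (simp add: vec_eq_iff forall_2 lin_nth axis_nth_2)
  then have "dot f (vector [a, c]) = 1" using f[of e1] by (simp add: axis_nth_2)
  then show "S \<in> ?R" using S act_lin_unital_family[OF nz f refl] by blast
next
  fix S assume "S \<in> ?R"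
  then obtain f u where u: "dot f u = 1" and S: "S = unital_family \<kappa> l \<beta> f u"
    by blast
  \<comment> \<open>The matrix has columns \<open>u\<close> and \<open>perp f\<close>; its
    determinant is \<open>dot f u\<close>, and \<open>f\<close> kills the second column.\<close>
  have nz: "u $ 1 * f $ 1 - (- f $ 2) * u $ 2 \<noteq> 0" using u by (simp add: dot_def algebra_simps)
  have "dot f (lin (u $ 1) (- f $ 2) (u $ 2) (f $ 1) x) = dot f u * x $ 1" for x
    by (simp add: dot_def lin_nth algebra_simps)
  then have "act (lin (u $ 1) (- f $ 2) (u $ 2) (f $ 1)) ?A = S"
    unfolding S using nz u by (intro act_lin_unital_family) (simp_all add: vec_eq_iff forall_2)
  then show "S \<in> GL_orbit ?A" unfolding GL_orbit_eq using nz by blast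
qed

definition nilpotent_family :: "complex \<Rightarrow> complex \<Rightarrow> V \<Rightarrow> lp_structure" where
  "nilpotent_family \<mu> \<nu> h =
     ((\<lambda>x y. (\<mu> * dot h x * dot h y) *s perp h), (\<lambda>x y. (\<nu> * dot h x * dot h y) *s perp h))"

text \<open>The scale \<open>z\<close> makes one computation serve both inclusions: it is a cube
  root of the determinant when \<open>h\<close> comes from a matrix, and 1 when the matrix is built
  from \<open>h\<close>.\<close>

lemma act_lin_nilpotent_family:
  assumes "a * d - b * c \<noteq> 0" "\<And>x. dot h (lin a b c d x) = z * x $ 1" "z ^ 2 *s perp h = vector [b, d]"
  shows "act (lin a b c d) (bil (\<mu> *s e2) 0 0 0, bil (\<nu> *s e2) 0 0 0) = nilpotent_family \<mu> \<nu> h"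
proof (rule act_eqI)
  show "lin a b c d \<in> GL" using assms(1) by (auto simp: GL_eq)
  fix x y
  have bil: "lin a b c d (bil (k *s e2) 0 0 0 x y) = (k * x $ 1 * y $ 1 * z ^ 2) *s perp h" for k
  proof -
    have "lin a b c d (bil (k *s e2) 0 0 0 x y) = (k * x $ 1 * y $ 1) *s vector [b, d]"
      by (simp add: vec_eq_iff forall_2 lin_nth bil_nth axis_nth_2)
    also have "\<dots> = (k * x $ 1 * y $ 1) *s (z ^ 2 *s perp h)" by (simp only: assms(3))
    finally show ?thesis by (simp only: vector_smult_assoc)
  qed
  show "lin a b c d (fst (bil (\<mu> *s e2) 0 0 0, bil (\<nu> *s e2) 0 0 0) x y) =
      fst (nilpotent_family \<mu> \<nu> h) (lin a b c d x) (lin a b c d y)"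
    "lin a b c d (snd (bil (\<mu> *s e2) 0 0 0, bil (\<nu> *s e2) 0 0 0) x y) =
      snd (nilpotent_family \<mu> \<nu> h) (lin a b c d x) (lin a b c d y)"
    unfolding nilpotent_family_def fst_conv snd_conv assms(2) bil
    by (simp_all add: power2_eq_square mult_ac)
qed

text \<open>A scalar factor of the structure tensor is absorbed into \<open>h\<close> by a cube root.\<close>

lemma orbit_nilpotent_family:
  "GL_orbit (bil (\<mu> *s e2) 0 0 0, bil (\<nu> *s e2) 0 0 0) = {nilpotent_family \<mu> \<nu> h | h. h \<noteq> 0}"
  (is "GL_orbit ?A = ?R")
proof (intro set_eqI iffI)
  fix S assume "S \<in> GL_orbit ?A"
  then obtain a b c d where nz: "a * d - b * c \<noteq> 0" and S: "S = act (lin a b c d) ?A"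
    unfolding GL_orbit_eq by blast
  obtain z where "a * d - b * c = z ^ 3" using exists_complex_root[of 3 "a * d - b * c"] by auto
  then have z: "z ^ 3 = a * d - b * c" by simp
  then have z0: "z \<noteq> 0" using nz by auto
  define f :: V where "f = vector [d / (a * d - b * c), - b / (a * d - b * c)]"
  have f: "dot f (lin a b c d x) = x $ 1" for x
    by (rule dual_basis(1)[OF nz f_def refl])
  have "dot (z *s f) (lin a b c d x) = z * x $ 1" for x
    using f[of x] by (simp add: dot_def algebra_simps flip: distrib_left)
  moreover have "z ^ 2 *s perp (z *s f) = vector [b, d]"
    unfolding f_def z[symmetric] using z0
    by (simp add: vec_eq_iff forall_2 perp_nth field_simps power2_eq_square power3_eq_cube)
  ultimately have "S = nilpotent_family \<mu> \<nu> (z *s f)"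
    using S act_lin_nilpotent_family[OF nz] by blast
  moreover have "z *s f \<noteq> 0"
    using \<open>z ^ 2 *s perp (z *s f) = vector [b, d]\<close> nz by (auto simp: vec_eq_iff forall_2 perp_nth)
  ultimately show "S \<in> ?R" by blast
next
  fix S assume "S \<in> ?R"
  then obtain h where h: "h \<noteq> 0" and S: "S = nilpotent_family \<mu> \<nu> h"
    by blast
  \<comment> \<open>A vector \<open>w\<close> on which \<open>h\<close> takes the value 1; the
    matrix with columns \<open>w\<close> and \<open>perp h\<close> then has determinant 1.\<close>
  obtain w1 w2 where w: "h $ 1 * w1 + h $ 2 * w2 = 1"
    using h unfolding vec_eq_iff forall_2
    by (metis add.left_neutral add.right_neutral mult_zero_right right_inverse zero_index)
  have nz: "w1 * h $ 1 - (- h $ 2) * w2 \<noteq> 0" using w by (simp add: algebra_simps)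
  have "dot h (lin w1 (- h $ 2) w2 (h $ 1) x) = (h $ 1 * w1 + h $ 2 * w2) * x $ 1" for x
    by (simp add: dot_def lin_nth algebra_simps)
  then have "act (lin w1 (- h $ 2) w2 (h $ 1)) ?A = S"
    unfolding S using nz w
    by (intro act_lin_nilpotent_family[where z = 1]) (simp_all add: vec_eq_iff forall_2 perp_nth)
  then show "S \<in> GL_orbit ?A" unfolding GL_orbit_eq using nz by blast
qed

text \<open>In the plane an alternating bilinear map is the determinant times a fixed
  vector.\<close>

definition lie_family :: "V \<Rightarrow> lp_structure" where
  "lie_family v = ((\<lambda>x y. 0), (\<lambda>x y. dot (perp x) y *s v))"

lemma dot_perp_lin: "dot (perp (lin a b c d x)) (lin a b c d y) = (a * d - b * c) * dot (perp x) y"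
  by (simp add: dot_def perp_nth lin_nth algebra_simps)

lemma act_lin_lie_family:
  assumes "a * d - b * c \<noteq> 0" "(a * d - b * c) *s v = vector [b, d]"
  shows "act (lin a b c d) (bil 0 0 0 0, bil 0 e2 (- e2) 0) = lie_family v"
proof (rule act_eqI)
  show "lin a b c d \<in> GL" using assms(1) by (auto simp: GL_eq)
  fix x y
  show "lin a b c d (fst (bil 0 0 0 0, bil 0 e2 (- e2) 0) x y) =
      fst (lie_family v) (lin a b c d x) (lin a b c d y)"
    by (simp add: lie_family_def vec_eq_iff forall_2 lin_nth bil_nth)
  have "lin a b c d (bil 0 e2 (- e2) 0 x y) = dot (perp x) y *s vector [b, d]"
    by (simp add: dot_def perp_nth vec_eq_iff forall_2 lin_nth bil_nth axis_nth_2 algebra_simps)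
  then show "lin a b c d (snd (bil 0 0 0 0, bil 0 e2 (- e2) 0) x y) =
      snd (lie_family v) (lin a b c d x) (lin a b c d y)"
    unfolding lie_family_def snd_conv dot_perp_lin assms(2)[symmetric] vector_smult_assoc
    by (simp only: mult.commute)
qed

lemma orbit_lie_family:
  "GL_orbit (bil 0 0 0 0, bil 0 e2 (- e2) 0) = {lie_family v | v. v \<noteq> 0}"
  (is "GL_orbit ?A = ?R")
proof (intro set_eqI iffI)
  fix S assume "S \<in> GL_orbit ?A"
  then obtain a b c d where nz: "a * d - b * c \<noteq> 0" and S: "S = act (lin a b c d) ?A"
    unfolding GL_orbit_eq by blast
  define v :: V where "v = vector [b / (a * d - b * c), d / (a * d - b * c)]"
  have v: "(a * d - b * c) *s v = vector [b, d]"
    unfolding v_def vec_eq_iff forall_2 vector_smult_component vector_2 using nz by simp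
  then have "v \<noteq> 0" using nz by (auto simp: vec_eq_iff forall_2)
  then show "S \<in> ?R" using S act_lin_lie_family[OF nz v] by blast
next
  fix S assume "S \<in> ?R"
  then obtain v where v: "v \<noteq> 0" and S: "S = lie_family v"
    by blast
  \<comment> \<open>Completes \<open>v\<close> to a basis of determinant 1, so that no scaling of
    \<open>v\<close> remains.\<close>
  obtain w1 w2 where w: "w1 * v $ 2 - v $ 1 * w2 = 1"
  proof (cases "v $ 1 = 0")
    case True
    then have "v $ 2 \<noteq> 0" using v by (auto simp: vec_eq_iff forall_2)
    then show ?thesis using True that[of "inverse (v $ 2)" 0] by simp
  next
    case False
    then show ?thesis using that[of 0 "- inverse (v $ 1)"] by simp
  qed
  then have "act (lin w1 (v $ 1) w2 (v $ 2)) ?A = S"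
    unfolding S by (intro act_lin_lie_family) (simp_all add: vec_eq_iff forall_2)
  moreover have "w1 * v $ 2 - v $ 1 * w2 \<noteq> 0" using w by simp
  ultimately show "S \<in> GL_orbit ?A" unfolding GL_orbit_eq by blast
qed

text \<open>Quadratic in \<open>v\<close> and linear in \<open>h\<close>: replacing \<open>v\<close>
  by a multiple \<open>s *s v\<close> and dividing \<open>h\<close> by \<open>s^2\<close> changes
  nothing, which leaves three parameters.\<close>

definition leibniz_family :: "V \<Rightarrow> V \<Rightarrow> lp_structure" where
  "leibniz_family h v = ((\<lambda>x y. 0), (\<lambda>x y. (dot h x * dot (perp v) y) *s v))"

lemma act_lin_leibniz_family:
  assumes "a * d - b * c \<noteq> 0" "\<And>x. (a * d - b * c) * dot h (lin a b c d x) = x $ 1" "v = vector [a, c]"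
  shows "act (lin a b c d) (bil 0 0 0 0, bil 0 e1 0 0) = leibniz_family h v"
proof (rule act_eqI)
  show "lin a b c d \<in> GL" using assms(1) by (auto simp: GL_eq)
  fix x y
  show "lin a b c d (fst (bil 0 0 0 0, bil 0 e1 0 0) x y) =
      fst (leibniz_family h v) (lin a b c d x) (lin a b c d y)"
    by (simp add: leibniz_family_def vec_eq_iff forall_2 lin_nth bil_nth)
  have v: "v = lin a b c d e1"
    by (simp add: assms(3) vec_eq_iff forall_2 lin_nth axis_nth_2)
  have "dot (perp v) (lin a b c d y) = (a * d - b * c) * y $ 2"
    unfolding v dot_perp_lin by (simp add: dot_def perp_nth axis_nth_2)
  then have "dot h (lin a b c d x) * dot (perp v) (lin a b c d y) =
      ((a * d - b * c) * dot h (lin a b c d x)) * y $ 2"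
    by (simp only: mult_ac)
  also have "\<dots> = x $ 1 * y $ 2" by (simp only: assms(2))
  finally show "lin a b c d (snd (bil 0 0 0 0, bil 0 e1 0 0) x y) =
      snd (leibniz_family h v) (lin a b c d x) (lin a b c d y)"
    by (simp add: leibniz_family_def v vec_eq_iff forall_2 lin_nth bil_nth axis_nth_2)
qed

lemma orbit_leibniz_family:
  "GL_orbit (bil 0 0 0 0, bil 0 e1 0 0) = {leibniz_family h v | h v. dot h v \<noteq> 0}"
  (is "GL_orbit ?A = ?R")
proof (intro set_eqI iffI)
  fix S assume "S \<in> GL_orbit ?A"
  then obtain a b c d where nz: "a * d - b * c \<noteq> 0" and S: "S = act (lin a b c d) ?A"
    unfolding GL_orbit_eq by blast
  define f :: V where "f = vector [d / (a * d - b * c), - b / (a * d - b * c)]"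
  have f: "dot f (lin a b c d x) = x $ 1" for x
    by (rule dual_basis(1)[OF nz f_def refl])
  define h where "h = inverse (a * d - b * c) *s f"
  have h: "(a * d - b * c) * dot h x = dot f x" for x
  proof -
    have "dot h x = inverse (a * d - b * c) * dot f x"
      by (simp only: h_def dot_def vector_smult_component distrib_left mult.assoc)
    then show ?thesis using nz by simp
  qed
  have "lin a b c d e1 = vector [a, c]" by (simp add: vec_eq_iff forall_2 lin_nth axis_nth_2)
  then have "dot h (vector [a, c]) \<noteq> 0" using f[of e1] h[of "vector [a, c]"] by (auto simp: axis_nth_2)
  moreover have "S = leibniz_family h (vector [a, c])"
    unfolding S using f h by (intro act_lin_leibniz_family[OF nz]) auto
  ultimately show "S \<in> ?R" by blast
next
  fix S assume "S \<in> ?R"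
  then obtain h v where k: "dot h v \<noteq> 0" and S: "S = leibniz_family h v"
    by blast
  \<comment> \<open>With columns \<open>v\<close> and \<open>q *s perp h\<close> the determinant is
    \<open>q * dot h v\<close>, and the form \<open>h\<close> sends the image of \<open>x\<close> to
    \<open>dot h v * x $ 1\<close>. The required normalization is therefore
    \<open>q * dot h v ^ 2 = 1\<close>.\<close>
  define q where "q = inverse (dot h v ^ 2)"
  let ?b = "- q * h $ 2" and ?d = "q * h $ 1"
  have D: "v $ 1 * ?d - ?b * v $ 2 = q * dot h v"
    by (simp add: dot_def algebra_simps)
  have h: "dot h (lin (v $ 1) ?b (v $ 2) ?d x) = dot h v * x $ 1" for x
    by (simp add: dot_def lin_nth algebra_simps)
  have q: "q * dot h v * dot h v = 1" "q * dot h v \<noteq> 0"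
    using k by (simp_all add: q_def power2_eq_square field_simps)
  have nz: "v $ 1 * ?d - ?b * v $ 2 \<noteq> 0"
    unfolding D by (rule q(2))
  have "act (lin (v $ 1) ?b (v $ 2) ?d) ?A = S"
    unfolding S
  proof (rule act_lin_leibniz_family[OF nz])
    show "(v $ 1 * ?d - ?b * v $ 2) * dot h (lin (v $ 1) ?b (v $ 2) ?d x) = x $ 1" for x
      unfolding D h using q(1) by (simp only: mult.assoc[symmetric] mult_1_left)
    show "v = vector [v $ 1, v $ 2]" by (simp add: vec_eq_iff forall_2)
  qed
  with nz show "S \<in> GL_orbit ?A" unfolding GL_orbit_eq by blast
qed

definition semisimple_family :: "V \<Rightarrow> V \<Rightarrow> V \<Rightarrow> V \<Rightarrow> lp_structure" where
  "semisimple_family f h v w =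
     ((\<lambda>x y. (dot f x * dot f y) *s v + (dot h x * dot h y) *s w), (\<lambda>x y. 0))"

text \<open>The idempotents move to the columns of the matrix and their coordinate forms to the rows
  of its inverse. All four entries survive, in agreement with the finite stabilizer.\<close>

lemma orbit_semisimple_family:
  "GL_orbit (bil e1 0 0 e2, bil 0 0 0 0) =
    {semisimple_family (vector [d / (a * d - b * c), - b / (a * d - b * c)])
       (vector [- c / (a * d - b * c), a / (a * d - b * c)]) (vector [a, c]) (vector [b, d])
     | a b c d. a * d - b * c \<noteq> 0}"
proof -
  have "act (lin a b c d) (bil e1 0 0 e2, bil 0 0 0 0) =
    semisimple_family (vector [d / (a * d - b * c), - b / (a * d - b * c)])
       (vector [- c / (a * d - b * c), a / (a * d - b * c)]) (vector [a, c]) (vector [b, d])"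
    if nz: "a * d - b * c \<noteq> 0" for a b c d
  proof (rule act_eqI)
    show "lin a b c d \<in> GL" using nz by (auto simp: GL_eq)
  qed (simp_all only: semisimple_family_def fst_conv snd_conv dual_basis[OF nz refl refl],
      simp_all add: vec_eq_iff forall_2 lin_nth bil_nth axis_nth_2 mult_ac)
  note act = this
  show ?thesis
    unfolding GL_orbit_eq by (intro Collect_cong iff_exI iffI; elim conjE; simp only: act simp_thms)
qed

section \<open>Dimensions of the orbits\<close>

lemmas ratfun_intros = ratfun.const ratfun.var ratfun.inv ratfun_diff ratfun_uminus ratfun_power
  ratfun.add ratfun.mult
lemmas mpoly_fun_intros = mpoly_fun.const mpoly_fun.var mpoly_fun_diff mpoly_fun_power
  mpoly_fun.add mpoly_fun.mult
lemmas polyfun_coords = polyfun.coord_product polyfun.coord_bracket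

definition params :: "complex list \<Rightarrow> nat \<Rightarrow> complex" where
  "params xs j = (if j < length xs then xs ! j else 0)"

lemma orbit_dim_nilpotent_family:
  assumes "\<mu> \<noteq> 0 \<or> \<nu> \<noteq> 0"
  shows "orbit_dim (bil (\<mu> *s e2) 0 0 0, bil (\<nu> *s e2) 0 0 0) = 2"
proof -
  let ?A = "(bil (\<mu> *s e2) 0 0 0, bil (\<nu> *s e2) 0 0 0)"
  define \<phi> where "\<phi> p = nilpotent_family \<mu> \<nu> (vector [p 0, p 1])" for p :: "nat \<Rightarrow> complex"
  have rat: "rational_map 2 D \<phi>" if "mpoly_fun 2 D" for D
    using that unfolding rational_map_def forall_2 \<phi>_def nilpotent_family_def dot_def
    by (simp add: axis_nth_2 perp_nth) (intro conjI ratfun_intros; simp)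
  \<comment> \<open>Whichever of product and bracket is nonzero supplies the separating functions;
    for \<open>L1\<close> only the bracket is available.\<close>
  obtain pr :: "lp_structure \<Rightarrow> V \<Rightarrow> V \<Rightarrow> V" and k where k: "k \<noteq> 0"
    and pr: "pr = fst \<and> k = \<mu> \<or> pr = snd \<and> k = \<nu>"
    using assms by blast
  have pr_\<phi>: "pr (\<phi> p) x y = (k * dot (vector [p 0, p 1]) x * dot (vector [p 0, p 1]) y) *s perp (vector [p 0, p 1])"
    for p x y
    using pr by (auto simp: \<phi>_def nilpotent_family_def)
  have pr_poly: "polyfun (\<lambda>A. pr A (axis i 1) (axis j 1) $ n)" for i j n
    using pr by (auto intro: polyfun_coords)
  \<comment> \<open>The denominator 1 reaches the whole orbit but also admits \<open>h = 0\<close>,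
    which gives the zero structure; \<open>p 0\<close> keeps \<open>h\<close> nonzero but loses the
    points with \<open>h $ 1 = 0\<close>.\<close>
  have "krull_dim (subtopology zariski (GL_orbit ?A)) = enat 2"
  proof (rule krull_dim_eqI[where \<phi> = \<phi> and D = "\<lambda>_. 1" and D' = "\<lambda>p. p 0" and c = "params [1, 0]"])
    show "rational_map 2 (\<lambda>_. 1) \<phi>" "rational_map 2 (\<lambda>p. p 0) \<phi>"
      by (rule rat, rule mpoly_fun_intros; simp)+
    show "GL_orbit ?A \<subseteq> Bil2" by (rule GL_orbit_subset_Bil2)
    show "GL_orbit ?A \<subseteq> \<phi> ` {p. (1::complex) \<noteq> 0}"
    proof
      fix S assume "S \<in> GL_orbit ?A"
      then obtain h where "S = nilpotent_family \<mu> \<nu> h" unfolding orbit_nilpotent_family by blast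
      moreover have "vector [h $ 1, h $ 2] = h" by (simp add: vec_eq_iff forall_2)
      ultimately have "S = \<phi> (params [h $ 1, h $ 2])" by (simp add: \<phi>_def params_def)
      then show "S \<in> \<phi> ` {p. (1::complex) \<noteq> 0}" by simp
    qed
    show "\<phi> ` {p. p 0 \<noteq> 0} \<subseteq> GL_orbit ?A"
    proof
      fix S assume "S \<in> \<phi> ` {p. p 0 \<noteq> 0}"
      then obtain p where p: "p 0 \<noteq> 0" "S = \<phi> p" by blast
      then have "vector [p 0, p 1] \<noteq> (0 :: V)" by (simp add: vec_eq_iff forall_2)
      then show "S \<in> GL_orbit ?A" using p(2) unfolding orbit_nilpotent_family \<phi>_def by blast
    qed
    show "params [1, 0] 0 \<noteq> 0" by (simp add: params_def)
    fix i :: nat assume "i < 2"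
    then consider "i = 0" | "i = 1" by linarith
    then show "\<exists>f p. polyfun f \<and>
      (\<forall>q. q 0 \<noteq> 0 \<longrightarrow> (\<forall>j\<ge>i. q j = params [1, 0] j) \<longrightarrow> f (\<phi> q) = 0) \<and>
      p 0 \<noteq> 0 \<and> (\<forall>j>i. p j = params [1, 0] j) \<and> f (\<phi> p) \<noteq> 0"
    proof cases
      case 1
      show ?thesis
        by (rule exI[of _ "\<lambda>A. pr A e1 e1 $ 2 - k"], rule exI[of _ "params [2, 0]"])
          (use 1 k in \<open>auto simp: pr_\<phi> dot_def axis_nth_2 perp_nth params_def nth_Cons'
            intro!: polyfun_minus_const pr_poly\<close>)
    next
      case 2
      show ?thesis
        by (rule exI[of _ "\<lambda>A. pr A e1 e1 $ 1"], rule exI[of _ "params [1, 1]"])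
          (use 2 k in \<open>auto simp: pr_\<phi> dot_def axis_nth_2 perp_nth params_def nth_Cons'
            intro!: pr_poly\<close>)
    qed
  qed
  then show ?thesis by (simp add: orbit_dim_def numeral_eq_enat)
qed

lemma orbit_dim_lie_family: "orbit_dim (bil 0 0 0 0, bil 0 e2 (- e2) 0) = 2"
proof -
  let ?A = "(bil 0 0 0 0, bil 0 e2 (- e2) 0)"
  define \<phi> where "\<phi> p = lie_family (vector [p 0, p 1])" for p :: "nat \<Rightarrow> complex"
  have rat: "rational_map 2 D \<phi>" if "mpoly_fun 2 D" for D
    using that unfolding rational_map_def forall_2 \<phi>_def lie_family_def dot_def
    by (simp add: axis_nth_2 perp_nth) (intro conjI ratfun_intros; simp)
  have "krull_dim (subtopology zariski (GL_orbit ?A)) = enat 2"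
  proof (rule krull_dim_eqI[where \<phi> = \<phi> and D = "\<lambda>_. 1" and D' = "\<lambda>p. p 0" and c = "params [1, 0]"])
    show "rational_map 2 (\<lambda>_. 1) \<phi>" "rational_map 2 (\<lambda>p. p 0) \<phi>"
      by (rule rat, rule mpoly_fun_intros; simp)+
    show "GL_orbit ?A \<subseteq> Bil2" by (rule GL_orbit_subset_Bil2)
    show "GL_orbit ?A \<subseteq> \<phi> ` {p. (1::complex) \<noteq> 0}"
    proof
      fix S assume "S \<in> GL_orbit ?A"
      then obtain v where "S = lie_family v" unfolding orbit_lie_family by blast
      moreover have "vector [v $ 1, v $ 2] = v" by (simp add: vec_eq_iff forall_2)
      ultimately have "S = \<phi> (params [v $ 1, v $ 2])" by (simp add: \<phi>_def params_def)
      then show "S \<in> \<phi> ` {p. (1::complex) \<noteq> 0}" by simp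
    qed
    show "\<phi> ` {p. p 0 \<noteq> 0} \<subseteq> GL_orbit ?A"
    proof
      fix S assume "S \<in> \<phi> ` {p. p 0 \<noteq> 0}"
      then obtain p where p: "p 0 \<noteq> 0" "S = \<phi> p" by blast
      then have "vector [p 0, p 1] \<noteq> (0 :: V)" by (simp add: vec_eq_iff forall_2)
      then show "S \<in> GL_orbit ?A" using p(2) unfolding orbit_lie_family \<phi>_def by blast
    qed
    show "params [1, 0] 0 \<noteq> 0" by (simp add: params_def)
    fix i :: nat assume "i < 2"
    then consider "i = 0" | "i = 1" by linarith
    then show "\<exists>f p. polyfun f \<and>
      (\<forall>q. q 0 \<noteq> 0 \<longrightarrow> (\<forall>j\<ge>i. q j = params [1, 0] j) \<longrightarrow> f (\<phi> q) = 0) \<and>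
      p 0 \<noteq> 0 \<and> (\<forall>j>i. p j = params [1, 0] j) \<and> f (\<phi> p) \<noteq> 0"
    proof cases
      case 1
      show ?thesis
        by (rule exI[of _ "\<lambda>A. snd A e1 e2 $ 1 - 1"], rule exI[of _ "params [2, 0]"])
          (use 1 in \<open>auto simp: \<phi>_def lie_family_def dot_def axis_nth_2 perp_nth params_def nth_Cons'
            intro!: polyfun_minus_const polyfun_coords\<close>)
    next
      case 2
      show ?thesis
        by (rule exI[of _ "\<lambda>A. snd A e1 e2 $ 2"], rule exI[of _ "params [1, 1]"])
          (use 2 in \<open>auto simp: \<phi>_def lie_family_def dot_def axis_nth_2 perp_nth params_def nth_Cons'
            intro!: polyfun_coords\<close>)
    qed
  qed
  then show ?thesis by (simp add: orbit_dim_def numeral_eq_enat)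
qed

lemma orbit_dim_leibniz_family: "orbit_dim (bil 0 0 0 0, bil 0 e1 0 0) = 3"
proof -
  let ?A = "(bil 0 0 0 0, bil 0 e1 0 0)"
  define \<phi> where "\<phi> p = leibniz_family (vector [p 0, p 1]) (vector [p 2 ^ 2 - 1, p 2])"
    for p :: "nat \<Rightarrow> complex"
  define D where "D p = p 0 * (p 2 ^ 2 - 1) + p 1 * p 2" for p :: "nat \<Rightarrow> complex"
  have mpoly: "mpoly_fun 3 D"
    unfolding D_def by (intro mpoly_fun_intros; simp)
  have rat: "rational_map 3 D \<phi>"
    using mpoly unfolding rational_map_def forall_2 \<phi>_def leibniz_family_def dot_def
    by (simp add: axis_nth_2 perp_nth) (intro conjI ratfun_intros; simp)
  have "krull_dim (subtopology zariski (GL_orbit ?A)) = enat 3"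
  proof (rule krull_dim_eqI[where \<phi> = \<phi> and D = D and D' = D and c = "params [1, 0, 0]"])
    show "GL_orbit ?A \<subseteq> Bil2" by (rule GL_orbit_subset_Bil2)
    show "GL_orbit ?A \<subseteq> \<phi> ` {p. D p \<noteq> 0}"
    proof
      fix S assume "S \<in> GL_orbit ?A"
      then obtain h v where hv: "dot h v \<noteq> 0" "S = leibniz_family h v"
        unfolding orbit_leibniz_family by blast
      then have "v $ 1 \<noteq> 0 \<or> v $ 2 \<noteq> 0" by (auto simp: dot_def)
      then obtain s t where st: "s \<noteq> 0" "v $ 1 = s * (t ^ 2 - 1)" "v $ 2 = s * t"
        by (rule direction_cover)
      \<comment> \<open>The length \<open>s\<close> of \<open>v\<close> is moved into
        \<open>h\<close>, where it counts twice because \<open>v\<close> occurs twice;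
        \<open>v\<close> keeps only its direction \<open>t\<close>.\<close>
      let ?p = "params [s ^ 2 * h $ 1, s ^ 2 * h $ 2, t]"
      have "D ?p = s * dot h v"
        by (simp add: D_def dot_def params_def st power2_eq_square algebra_simps)
      moreover have "S = \<phi> ?p"
        unfolding hv(2) \<phi>_def leibniz_family_def
        by (intro prod_eqI ext)
          (simp_all add: dot_def perp_nth params_def st vec_eq_iff forall_2 power2_eq_square algebra_simps)
      ultimately show "S \<in> \<phi> ` {p. D p \<noteq> 0}" using hv st by auto
    qed
    show "\<phi> ` {p. D p \<noteq> 0} \<subseteq> GL_orbit ?A"
    proof
      fix S assume "S \<in> \<phi> ` {p. D p \<noteq> 0}"
      then obtain p where p: "D p \<noteq> 0" "S = \<phi> p" by blast
      then have "dot (vector [p 0, p 1]) (vector [p 2 ^ 2 - 1, p 2]) \<noteq> 0" by (simp add: D_def dot_def)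
      then show "S \<in> GL_orbit ?A" using p(2) unfolding orbit_leibniz_family \<phi>_def by blast
    qed
    show "D (params [1, 0, 0]) \<noteq> 0" by (simp add: params_def D_def)
    fix i :: nat assume "i < 3"
    then consider "i = 0" | "i = 1" | "i = 2" by linarith
    then show "\<exists>f p. polyfun f \<and>
      (\<forall>q. D q \<noteq> 0 \<longrightarrow> (\<forall>j\<ge>i. q j = params [1, 0, 0] j) \<longrightarrow> f (\<phi> q) = 0) \<and>
      D p \<noteq> 0 \<and> (\<forall>j>i. p j = params [1, 0, 0] j) \<and> f (\<phi> p) \<noteq> 0"
    proof cases
      case 1
      show ?thesis
        by (rule exI[of _ "\<lambda>A. snd A e1 e2 $ 1 - 1"], rule exI[of _ "params [2, 0, 0]"])
          (use 1 in \<open>auto simp: D_def \<phi>_def leibniz_family_def dot_def axis_nth_2 perp_nth params_def nth_Cons'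
            intro!: polyfun_minus_const polyfun_coords\<close>)
    next
      case 2
      show ?thesis
        by (rule exI[of _ "\<lambda>A. snd A e2 e2 $ 1"], rule exI[of _ "params [1, 1, 0]"])
          (use 2 in \<open>auto simp: D_def \<phi>_def leibniz_family_def dot_def axis_nth_2 perp_nth params_def nth_Cons'
            intro!: polyfun_coords\<close>)
    next
      case 3
      show ?thesis
        by (rule exI[of _ "\<lambda>A. snd A e1 e2 $ 2"], rule exI[of _ "params [1, 0, 2]"])
          (use 3 in \<open>auto simp: D_def \<phi>_def leibniz_family_def dot_def axis_nth_2 perp_nth params_def nth_Cons'
            intro!: polyfun_coords\<close>)
    qed
  qed (rule rat)+
  then show ?thesis by (simp add: orbit_dim_def numeral_eq_enat)
qed

text \<open>\<open>2 * \<kappa> + l = 1\<close> says that \<open>e1\<close> is idempotent. With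
  \<open>l \<noteq> 0\<close> the product contains \<open>u\<close>, so products of basis vectors
  can separate the parameters.\<close>

lemma orbit_dim_unital_family:
  assumes "2 * \<kappa> + l = 1" "l \<noteq> 0"
  shows "orbit_dim (bil ((2 * \<kappa> + l) *s e1) (\<kappa> *s e2) (\<kappa> *s e2) 0, bil 0 0 (\<beta> *s e2) 0) = 3"
proof -
  let ?A = "(bil ((2 * \<kappa> + l) *s e1) (\<kappa> *s e2) (\<kappa> *s e2) 0, bil 0 0 (\<beta> *s e2) 0)"
  \<comment> \<open>With \<open>f = s *s (t\<^sup>2 - 1, t)\<close>, the Bezout identity \<open>t * t - (t\<^sup>2 - 1) = 1\<close> solves \<open>dot f u = 1\<close>.\<close>
  define \<phi> where "\<phi> p = unital_family \<kappa> l \<beta> (vector [p 0 * (p 2 ^ 2 - 1), p 0 * p 2])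
      (vector [- inverse (p 0) - p 1 * p 2, p 2 * inverse (p 0) + p 1 * (p 2 ^ 2 - 1)])"
    for p :: "nat \<Rightarrow> complex"
  have mpoly: "mpoly_fun 3 (\<lambda>p. p 0)"
    by (intro mpoly_fun_intros; simp)
  have rat: "rational_map 3 (\<lambda>p. p 0) \<phi>"
    using mpoly unfolding rational_map_def forall_2 \<phi>_def unital_family_def dot_def
    by (simp add: axis_nth_2) (intro conjI ratfun_intros; simp)
  have "krull_dim (subtopology zariski (GL_orbit ?A)) = enat 3"
  proof (rule krull_dim_eqI[where \<phi> = \<phi> and D = "\<lambda>p. p 0" and D' = "\<lambda>p. p 0" and c = "params [1, 0, 0]"])
    show "GL_orbit ?A \<subseteq> Bil2" by (rule GL_orbit_subset_Bil2)
    show "GL_orbit ?A \<subseteq> \<phi> ` {p. p 0 \<noteq> 0}"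
    proof
      fix S assume "S \<in> GL_orbit ?A"
      then obtain f u where fu: "dot f u = 1" "S = unital_family \<kappa> l \<beta> f u"
        unfolding orbit_unital_family by blast
      then have "f $ 1 \<noteq> 0 \<or> f $ 2 \<noteq> 0" by (auto simp: dot_def)
      then obtain s t where st: "s \<noteq> 0" "f $ 1 = s * (t ^ 2 - 1)" "f $ 2 = s * t"
        by (rule direction_cover)
      define i where "i = inverse s"
      \<comment> \<open>For \<open>i = inverse s\<close>, the vector \<open>i *s (-1, t)\<close>
        solves \<open>dot f u = 1\<close>, and the kernel of \<open>f\<close> is spanned by
        \<open>(-t, t^2 - 1)\<close>. Pairing \<open>u\<close> with \<open>(t, 1)\<close> kills the
        first vector and gives -1 on the second, so it reads off \<open>- r\<close>.\<close>
      define r where "r = - (t * u $ 1 + u $ 2)"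
      have "s * ((t ^ 2 - 1) * u $ 1 + t * u $ 2) = 1"
        using fu(1) by (simp add: dot_def st algebra_simps)
      then have i_eq: "i = (t ^ 2 - 1) * u $ 1 + t * u $ 2"
        unfolding i_def by (simp add: inverse_unique)
      have "u $ 1 = - i - r * t" "u $ 2 = t * i + r * (t ^ 2 - 1)"
        unfolding r_def i_eq by (simp_all add: algebra_simps power2_eq_square)
      then have "u = vector [- i - r * t, t * i + r * (t ^ 2 - 1)]" "f = vector [s * (t ^ 2 - 1), s * t]"
        using st by (simp_all add: vec_eq_iff forall_2)
      then have "S = \<phi> (params [s, r, t])"
        unfolding fu(2) \<phi>_def i_def by (simp add: params_def)
      then show "S \<in> \<phi> ` {p. p 0 \<noteq> 0}" using st(1) by (auto simp: params_def)
    qed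
    show "\<phi> ` {p. p 0 \<noteq> 0} \<subseteq> GL_orbit ?A"
    proof
      fix S assume "S \<in> \<phi> ` {p. p 0 \<noteq> 0}"
      then obtain p where p: "p 0 \<noteq> 0" "S = \<phi> p" by blast
      then have i: "p 0 * inverse (p 0) = 1" by simp
      have "dot (vector [p 0 * (p 2 ^ 2 - 1), p 0 * p 2])
        (vector [- inverse (p 0) - p 1 * p 2, p 2 * inverse (p 0) + p 1 * (p 2 ^ 2 - 1)]) = 1"
        unfolding dot_def vector_2 using i by algebra
      then show "S \<in> GL_orbit ?A" using p(2) unfolding orbit_unital_family \<phi>_def by blast
    qed
    show "params [1, 0, 0] 0 \<noteq> 0" by (simp add: params_def)
    have l: "l = 1 - 2 * \<kappa>" using assms(1) by (simp add: algebra_simps)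
    fix i :: nat assume "i < 3"
    then consider "i = 0" | "i = 1" | "i = 2" by linarith
    then show "\<exists>f p. polyfun f \<and>
      (\<forall>q. q 0 \<noteq> 0 \<longrightarrow> (\<forall>j\<ge>i. q j = params [1, 0, 0] j) \<longrightarrow> f (\<phi> q) = 0) \<and>
      p 0 \<noteq> 0 \<and> (\<forall>j>i. p j = params [1, 0, 0] j) \<and> f (\<phi> p) \<noteq> 0"
    proof cases
      case 1
      \<comment> \<open>While only \<open>p 0\<close> is free, \<open>f\<close> is
        \<open>(- p 0, 0)\<close>, and the structure constant equals \<open>- p 0\<close>; hence the
        shift by 1.\<close>
      show ?thesis
        by (rule exI[of _ "\<lambda>A. fst A e1 e1 $ 1 + 1"], rule exI[of _ "params [2, 0, 0]"])
          (use 1 in \<open>auto simp: \<phi>_def unital_family_def dot_def axis_nth_2 params_def nth_Cons' l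
            intro!: polyfun.add polyfun.const polyfun_coords\<close>)
    next
      case 2
      show ?thesis
        by (rule exI[of _ "\<lambda>A. fst A e1 e1 $ 2"], rule exI[of _ "params [1, 1, 0]"])
          (use 2 assms(2) in \<open>auto simp: \<phi>_def unital_family_def dot_def axis_nth_2 params_def nth_Cons'
            intro!: polyfun_coords\<close>)
    next
      case 3
      show ?thesis
        by (rule exI[of _ "\<lambda>A. fst A e2 e2 $ 1"], rule exI[of _ "params [1, 0, 1]"])
          (use 3 assms(2) in \<open>auto simp: \<phi>_def unital_family_def dot_def axis_nth_2 params_def nth_Cons'
            intro!: polyfun_coords\<close>)
    qed
  qed (rule rat)+
  then show ?thesis by (simp add: orbit_dim_def numeral_eq_enat)
qed

lemma orbit_dim_semisimple_family: "orbit_dim (bil e1 0 0 e2, bil 0 0 0 0) = 4"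
proof -
  let ?A = "(bil e1 0 0 e2, bil 0 0 0 0)"
  \<comment> \<open>The parameters are the matrix entries in the order \<open>d\<close>,
    \<open>b\<close>, \<open>a\<close>, \<open>c\<close>. The entry \<open>c\<close> is released
    last, so that the matrix stays upper triangular and a single structure constant detects each
    step.\<close>
  define D where "D p = p 2 * p 0 - p 1 * p 3" for p :: "nat \<Rightarrow> complex"
  define \<phi> where "\<phi> p = semisimple_family (vector [p 0 * inverse (D p), - p 1 * inverse (D p)])
      (vector [- p 3 * inverse (D p), p 2 * inverse (D p)]) (vector [p 2, p 3]) (vector [p 1, p 0])"
    for p :: "nat \<Rightarrow> complex"
  have mpoly: "mpoly_fun 4 D"
    unfolding D_def by (intro mpoly_fun_intros; simp)
  have rat: "rational_map 4 D \<phi>"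
    using mpoly unfolding rational_map_def forall_2 \<phi>_def semisimple_family_def dot_def
    by (simp add: axis_nth_2) (intro conjI ratfun_intros; simp)
  have "krull_dim (subtopology zariski (GL_orbit ?A)) = enat 4"
  proof (rule krull_dim_eqI[where \<phi> = \<phi> and D = D and D' = D and c = "params [1, 0, 1, 0]"])
    show "GL_orbit ?A \<subseteq> Bil2" by (rule GL_orbit_subset_Bil2)
    show "GL_orbit ?A \<subseteq> \<phi> ` {p. D p \<noteq> 0}"
    proof
      fix S assume "S \<in> GL_orbit ?A"
      then obtain a b c d where nz: "a * d - b * c \<noteq> 0" and
        S: "S = semisimple_family (vector [d / (a * d - b * c), - b / (a * d - b * c)])
          (vector [- c / (a * d - b * c), a / (a * d - b * c)]) (vector [a, c]) (vector [b, d])"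
        unfolding orbit_semisimple_family by blast
      have D: "D (params [d, b, a, c]) = a * d - b * c" by (simp add: D_def params_def)
      have "S = \<phi> (params [d, b, a, c])"
        unfolding \<phi>_def D S by (simp add: params_def divide_inverse)
      then show "S \<in> \<phi> ` {p. D p \<noteq> 0}" using D nz by auto
    qed
    show "\<phi> ` {p. D p \<noteq> 0} \<subseteq> GL_orbit ?A"
    proof
      fix S assume "S \<in> \<phi> ` {p. D p \<noteq> 0}"
      then obtain p where p: "D p \<noteq> 0" "S = \<phi> p" by blast
      then show "S \<in> GL_orbit ?A"
        unfolding orbit_semisimple_family \<phi>_def D_def divide_inverse by blast
    qed
    show "D (params [1, 0, 1, 0]) \<noteq> 0" by (simp add: params_def D_def)
    fix i :: nat assume "i < 4"
    then consider "i = 0" | "i = 1" | "i = 2" | "i = 3" by linarith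
    then show "\<exists>f p. polyfun f \<and>
      (\<forall>q. D q \<noteq> 0 \<longrightarrow> (\<forall>j\<ge>i. q j = params [1, 0, 1, 0] j) \<longrightarrow> f (\<phi> q) = 0) \<and>
      D p \<noteq> 0 \<and> (\<forall>j>i. p j = params [1, 0, 1, 0] j) \<and> f (\<phi> p) \<noteq> 0"
    proof cases
      case 1
      show ?thesis
        by (rule exI[of _ "\<lambda>A. fst A e2 e2 $ 2 - 1"], rule exI[of _ "params [2, 0, 1, 0]"])
          (use 1 in \<open>auto simp: D_def \<phi>_def semisimple_family_def dot_def axis_nth_2 params_def nth_Cons'
            intro!: polyfun_minus_const polyfun_coords\<close>)
    next
      case 2
      show ?thesis
        by (rule exI[of _ "\<lambda>A. fst A e1 e2 $ 1"], rule exI[of _ "params [1, 1, 1, 0]"])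
          (use 2 in \<open>auto simp: D_def \<phi>_def semisimple_family_def dot_def axis_nth_2 params_def nth_Cons'
            intro!: polyfun_coords\<close>)
    next
      case 3
      show ?thesis
        by (rule exI[of _ "\<lambda>A. fst A e1 e1 $ 1 - 1"], rule exI[of _ "params [1, 0, 2, 0]"])
          (use 3 in \<open>auto simp: D_def \<phi>_def semisimple_family_def dot_def axis_nth_2 params_def nth_Cons'
            intro!: polyfun_minus_const polyfun_coords\<close>)
    next
      case 4
      show ?thesis
        by (rule exI[of _ "\<lambda>A. fst A e1 e1 $ 2"], rule exI[of _ "params [1, 0, 1, 1]"])
          (use 4 in \<open>auto simp: D_def \<phi>_def semisimple_family_def dot_def axis_nth_2 params_def nth_Cons'
            intro!: polyfun_coords\<close>)
    qed
  qed (rule rat)+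
  then show ?thesis by (simp add: orbit_dim_def numeral_eq_enat)
qed

lemma orbit_dim_zero: "orbit_dim (bil 0 0 0 0, bil 0 0 0 0) = 0"
proof -
  let ?A = "(bil 0 0 0 0, bil 0 0 0 0)"
  have "act (lin a b c d) ?A = ?A" for a b c d
    by (simp add: act_def bil_def fun_eq_iff vec_eq_iff forall_2 lin_nth)
  moreover have "\<exists>a b c d. a * d - b * c \<noteq> (0 :: complex)"
    by (intro exI[of _ 1] exI[of _ 0]) simp
  ultimately have orbit: "GL_orbit ?A = {?A}"
    unfolding GL_orbit_eq by auto
  have "krull_dim (subtopology zariski (GL_orbit ?A)) = enat 0"
    by (rule krull_dim_eqI[where \<phi> = "\<lambda>_. ?A" and D = "\<lambda>_. 1" and D' = "\<lambda>_. 1"])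
      (auto simp: rational_map_def orbit Bil2_def cbilinear_bil intro: mpoly_fun.intros ratfun.intros)
  then show ?thesis by (simp add: orbit_dim_def zero_enat_def)
qed

section \<open>Degenerations\<close>

lemma lin_id: "lin 1 0 0 1 x = x"
  by (simp add: vec_eq_iff forall_2 lin_nth)

lemma closure_polyfun_zero:
  assumes "S \<in> zariski closure_of X" "X \<subseteq> Bil2" "polyfun f" "\<And>A. A \<in> X \<Longrightarrow> f A = 0"
  shows "f S = 0"
proof -
  have "zariski closure_of X \<subseteq> zero_locus {f}"
    using assms by (intro closure_of_minimal) (auto simp: closedin_zariski zero_locus_def)
  then show ?thesis using assms(1) by (auto simp: zero_locus_def)
qed

lemma closure_subset_Bil2: "zariski closure_of X \<subseteq> Bil2"
  using closure_of_subset_topspace[of zariski X] by (simp add: topspace_zariski)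

text \<open>A polynomial that vanishes on the orbit vanishes along the curve for
  \<open>s \<noteq> 0\<close>, hence at 0 by continuity: limits in the usual topology belong to the
  Zariski closure.\<close>

lemma degenerates_of_curve:
  assumes "\<And>s. s \<noteq> 0 \<Longrightarrow> \<gamma> s \<in> GL_orbit A" "GL_orbit A \<subseteq> Bil2" "\<gamma> 0 = B" "B \<in> Bil2"
    and cont: "\<forall>i j k. isCont (\<lambda>s. fst (\<gamma> s) (axis i 1) (axis j 1) $ k) (0::complex)"
      "\<forall>i j k. isCont (\<lambda>s. snd (\<gamma> s) (axis i 1) (axis j 1) $ k) 0"
  shows "degenerates A B"
proof -
  obtain F where F: "\<And>f. f \<in> F \<Longrightarrow> polyfun f" "zariski closure_of (GL_orbit A) = zero_locus F"
    using closedin_closure_of[of zariski "GL_orbit A"] unfolding closedin_zariski by blast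
  have "f B = 0" if f: "f \<in> F" for f
  proof -
    have "isCont (\<lambda>s. f (\<gamma> s)) 0"
      using F(1)[OF f] by (induction rule: polyfun.induct) (use cont in \<open>auto intro: continuous_intros\<close>)
    then have "((\<lambda>s. f (\<gamma> s)) \<longlongrightarrow> f B) (at 0)"
      using assms(3) by (simp add: isCont_def)
    moreover have "f (\<gamma> s) = 0" if "s \<noteq> 0" for s
    proof -
      have "\<gamma> s \<in> zariski closure_of (GL_orbit A)"
        using closure_of_subset[of "GL_orbit A" zariski] assms(1)[OF that] assms(2)
        by (auto simp: topspace_zariski)
      then show ?thesis using f by (simp add: F(2) zero_locus_def)
    qed
    then have "((\<lambda>s. f (\<gamma> s)) \<longlongrightarrow> 0) (at 0)"
      by (intro tendsto_eventually) (auto simp: eventually_at_filter)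
    ultimately show ?thesis
      by (metis tendsto_unique at_neq_bot)
  qed
  then have "B \<in> zariski closure_of (GL_orbit A)"
    unfolding F(2) using assms(4) by (simp add: zero_locus_def)
  moreover have "lp_isomorphic B B"
    unfolding lp_isomorphic_def
    by (intro exI[of _ "lin 1 0 0 1"]) (simp add: linear_lin bij_lin_iff lin_id)
  ultimately show ?thesis unfolding degenerates_def by blast
qed

text \<open>The given matrix is the isomorphism from \<open>B\<close> to \<open>A\<close>, inverse
  to the acting element. Its columns are the new basis written in the old one, so the curves can be
  checked without fractions.\<close>

lemma in_GL_orbitI:
  assumes nz: "a * d - b * c \<noteq> 0"
    and "\<And>x y. lin a b c d (fst B x y) = fst A (lin a b c d x) (lin a b c d y)"
    "\<And>x y. lin a b c d (snd B x y) = snd A (lin a b c d x) (lin a b c d y)"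
  shows "B \<in> GL_orbit A"
proof -
  define e where "e = inverse (a * d - b * c)"
  define h where "h = lin (d * e) (- b * e) (- c * e) (a * e)"
  have h: "h (lin a b c d x) = x" "lin a b c d (h x) = x" for x
    using lin_inverse[OF nz e_def] by (simp_all add: h_def)
  have "h \<in> GL"
    using o_bij[of "lin a b c d" h] linear_lin h unfolding GL_def h_def[symmetric]
    by (auto simp: fun_eq_iff h_def)
  moreover have "inv h = lin a b c d"
    using h by (intro inv_equality) auto
  then have "act h A = B"
    by (simp add: act_def assms(2,3)[symmetric] h)
  ultimately show ?thesis unfolding GL_orbit_def by blast
qed

lemma GL_orbit_lp_algebra_subset: "GL_orbit (lp_algebra T) \<subseteq> Bil2"
  by (cases T) (simp_all add: GL_orbit_subset_Bil2)

lemma lp_algebra_Bil2: "lp_algebra T \<in> Bil2"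
  by (cases T) (simp_all add: Bil2_def cbilinear_bil)

lemma cbilinear_scale:
  assumes "cbilinear m"
  shows "m (s *s x) (s *s y) = (s * s) *s m x y"
  by (subst (1 2) cbilinear_eq_bil[OF assms]) (simp add: bil_nth vec_eq_iff algebra_simps)

text \<open>A homothety multiplies every bilinear structure by a scalar, and this scalar is sent to
  0.\<close>

lemma degenerates_zero: "degenerates (lp_algebra T) (lp_algebra Zero)"
proof -
  let ?A = "lp_algebra T"
  have bil: "cbilinear (fst ?A)" "cbilinear (snd ?A)"
    using lp_algebra_Bil2[of T] by (auto simp: Bil2_def case_prod_beta)
  show ?thesis
  proof (rule degenerates_of_curve[where \<gamma> = "\<lambda>s. ((\<lambda>x y. s *s fst ?A x y), (\<lambda>x y. s *s snd ?A x y))"])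
    fix s :: complex assume s: "s \<noteq> 0"
    have "lin s 0 0 s x = s *s x" for x by (simp add: vec_eq_iff forall_2 lin_nth)
    then show "((\<lambda>x y. s *s fst ?A x y), (\<lambda>x y. s *s snd ?A x y)) \<in> GL_orbit ?A"
      using s by (intro in_GL_orbitI[of s s 0 0]) (simp_all add: cbilinear_scale[OF bil(1)] cbilinear_scale[OF bil(2)])
  qed (auto simp: GL_orbit_lp_algebra_subset lp_algebra_Bil2 bil_def fun_eq_iff simp del: lp_algebra.simps,
      auto simp: bil_def fun_eq_iff)
qed

text \<open>Each curve below expresses the source algebra in a basis that depends on \<open>s\<close>, given by the
  columns of the matrix passed to \<open>in_GL_orbitI\<close>, and becomes the target at \<open>s = 0\<close>.\<close>

lemma degenerates_L4_L5: "degenerates (lp_algebra L4) (lp_algebra (L5 0))"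
proof (rule degenerates_of_curve[where \<gamma> = "\<lambda>s. (bil e1 e2 e2 (s *s e2), bil 0 0 0 0)"])
  show "(bil e1 e2 e2 (s *s e2), bil 0 0 0 0) \<in> GL_orbit (lp_algebra L4)" if "s \<noteq> 0" for s
    by (rule in_GL_orbitI[of 1 s 0 1])
      (use that in \<open>simp_all add: vec_eq_iff forall_2 lin_nth bil_nth axis_nth_2 algebra_simps\<close>)
qed (simp_all only: GL_orbit_lp_algebra_subset lp_algebra_Bil2,
    auto simp: fun_eq_iff vec_eq_iff forall_2 bil_nth axis_nth_2 intro!: continuous_intros)

lemma degenerates_L4_L6: "degenerates (lp_algebra L4) (lp_algebra (L6 0))"
proof (rule degenerates_of_curve[where \<gamma> = "\<lambda>s. (bil e1 0 0 (s *s e2), bil 0 0 0 0)"])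
  show "(bil e1 0 0 (s *s e2), bil 0 0 0 0) \<in> GL_orbit (lp_algebra L4)" if "s \<noteq> 0" for s
    by (rule in_GL_orbitI[of 1 s 0 0])
      (use that in \<open>simp_all add: vec_eq_iff forall_2 lin_nth bil_nth axis_nth_2 algebra_simps\<close>)
qed (simp_all only: GL_orbit_lp_algebra_subset lp_algebra_Bil2,
    auto simp: fun_eq_iff vec_eq_iff forall_2 bil_nth axis_nth_2 intro!: continuous_intros)

text \<open>The basis is \<open>E1 = (s, 2 s)\<close> together with its square \<open>E2\<close>.
  The eigenvalues \<open>s\<close> and \<open>2 s\<close> give
  \<open>E1^3 = 3 s E1^2 - 2 s^2 E1\<close>, and multiplying once more by \<open>E1\<close> gives
  the coefficients -6 and 7.\<close>

lemma degenerates_L4_L7: "degenerates (lp_algebra L4) (lp_algebra (L7 0))"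
proof (rule degenerates_of_curve[where \<gamma> = "\<lambda>s. (bil e2 (vector [- 2 * s ^ 2, 3 * s])
    (vector [- 2 * s ^ 2, 3 * s]) (vector [- 6 * s ^ 3, 7 * s ^ 2]), bil 0 0 0 0)"])
  show "(bil e2 (vector [- 2 * s ^ 2, 3 * s]) (vector [- 2 * s ^ 2, 3 * s])
      (vector [- 6 * s ^ 3, 7 * s ^ 2]), bil 0 0 0 0) \<in> GL_orbit (lp_algebra L4)" if "s \<noteq> 0" for s
    by (rule in_GL_orbitI[of s "4 * s ^ 2" "s ^ 2" "2 * s"])
      (use that in \<open>simp_all add: vec_eq_iff forall_2 lin_nth bil_nth axis_nth_2 algebra_simps
        power2_eq_square power3_eq_cube\<close>)
qed (simp_all only: GL_orbit_lp_algebra_subset lp_algebra_Bil2,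
    auto simp: fun_eq_iff vec_eq_iff forall_2 bil_nth axis_nth_2 intro!: continuous_intros)

lemma degenerates_L5_L7: "degenerates (lp_algebra (L5 \<beta>)) (lp_algebra (L7 \<beta>))"
proof (rule degenerates_of_curve[where \<gamma> = "\<lambda>s. (bil (vector [s, 1]) (s *s e2) (s *s e2) 0,
    bil (\<beta> *s e2) 0 ((\<beta> * s) *s e2) 0)"])
  show "(bil (vector [s, 1]) (s *s e2) (s *s e2) 0, bil (\<beta> *s e2) 0 ((\<beta> * s) *s e2) 0)
      \<in> GL_orbit (lp_algebra (L5 \<beta>))" if "s \<noteq> 0" for s
    by (rule in_GL_orbitI[of s s 0 1])
      (use that in \<open>simp_all add: vec_eq_iff forall_2 lin_nth bil_nth axis_nth_2 algebra_simps\<close>)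
qed (simp_all only: GL_orbit_lp_algebra_subset lp_algebra_Bil2,
    auto simp: fun_eq_iff vec_eq_iff forall_2 bil_nth axis_nth_2 intro!: continuous_intros)

text \<open>The origin of the sign: for \<open>E1 = s e1 + e2\<close> the product gives
  \<open>s^2 e1 = s E1 - s e2\<close>, which forces \<open>E2 = - s e2\<close>. In \<open>L5\<close>
  the same square is \<open>s E1 + s e2\<close>.\<close>

lemma degenerates_L6_L7: "degenerates (lp_algebra (L6 \<beta>)) (lp_algebra (L7 (- \<beta>)))"
proof (rule degenerates_of_curve[where \<gamma> = "\<lambda>s. (bil (vector [s, 1]) 0 0 0,
    bil (- \<beta> *s e2) 0 ((\<beta> * s) *s e2) 0)"])
  show "(bil (vector [s, 1]) 0 0 0, bil (- \<beta> *s e2) 0 ((\<beta> * s) *s e2) 0)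
      \<in> GL_orbit (lp_algebra (L6 \<beta>))" if "s \<noteq> 0" for s
    by (rule in_GL_orbitI[of s "- s" 0 1])
      (use that in \<open>simp_all add: vec_eq_iff forall_2 lin_nth bil_nth axis_nth_2 algebra_simps\<close>)
qed (simp_all only: GL_orbit_lp_algebra_subset lp_algebra_Bil2,
    auto simp: fun_eq_iff vec_eq_iff forall_2 bil_nth axis_nth_2 intro!: continuous_intros)

lemma degenerates_L2_L1: "degenerates (lp_algebra L2) (lp_algebra L1)"
proof (rule degenerates_of_curve[where \<gamma> = "\<lambda>s. (bil 0 0 0 0, bil e2 0 (s *s e2) 0)"])
  show "(bil 0 0 0 0, bil e2 0 (s *s e2) 0) \<in> GL_orbit (lp_algebra L2)" if "s \<noteq> 0" for s
    by (rule in_GL_orbitI[of 1 0 s s])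
      (use that in \<open>simp_all add: vec_eq_iff forall_2 lin_nth bil_nth axis_nth_2 algebra_simps\<close>)
qed (simp_all only: GL_orbit_lp_algebra_subset lp_algebra_Bil2,
    auto simp: fun_eq_iff vec_eq_iff forall_2 bil_nth axis_nth_2 intro!: continuous_intros)

text \<open>Takes the place of transitivity of degeneration: chains are so short that every pair
  joined by one has a curve of its own. From \<open>L4\<close> both routes through
  \<open>L5 0\<close> and \<open>L6 0\<close> meet in \<open>L7 0\<close>, as 0 is its own
  negative.\<close>

lemma tranclp_primary_degeneration_cases:
  assumes "primary_degeneration\<^sup>+\<^sup>+ T T'"
  shows "primary_degeneration T T' \<or> T' = Zero \<or> T = L4 \<and> T' = L7 0"
  using assms
proof (induction rule: tranclp_induct)
  case (step U W)
  then show ?case by (elim disjE) (auto elim!: primary_degeneration.cases)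
qed simp

lemma tranclp_primary_degeneration_degenerates:
  "primary_degeneration\<^sup>+\<^sup>+ T T' \<Longrightarrow> degenerates (lp_algebra T) (lp_algebra T')"
proof (drule tranclp_primary_degeneration_cases, elim disjE conjE)
  assume "primary_degeneration T T'"
  then show ?thesis
    by (cases rule: primary_degeneration.cases)
      (simp_all only: degenerates_zero degenerates_L4_L5 degenerates_L4_L6 degenerates_L5_L7
        degenerates_L6_L7 degenerates_L2_L1)
qed (simp_all only: degenerates_zero degenerates_L4_L7)

section \<open>Invariant identities that exclude degenerations\<close>

definition trace2 :: "(V \<Rightarrow> V) \<Rightarrow> complex" where
  "trace2 m = m e1 $ 1 + m e2 $ 2"

text \<open>Closed conditions that hold on the orbit of the algebra \<open>T\<close> and exclude every algebra
  of the list to which \<open>T\<close> does not degenerate.\<close>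

fun orbit_identities :: "lp_name \<Rightarrow> lp_structure \<Rightarrow> V \<Rightarrow> V \<Rightarrow> bool" where
  "orbit_identities L1 (m, b) x y \<longleftrightarrow> m x y = 0 \<and> b x y = b y x"
| "orbit_identities L2 (m, b) x y \<longleftrightarrow> m x y = 0 \<and> trace2 (b x) = 0"
| "orbit_identities L3 (m, b) x y \<longleftrightarrow> m x y = 0 \<and> b x y = - b y x"
| "orbit_identities L4 (m, b) x y \<longleftrightarrow> b x y = 0"
| "orbit_identities (L5 \<beta>) (m, b) x y \<longleftrightarrow>
     2 *s b x y = \<beta> *s (2 *s m x y - trace2 (m x) *s y) \<and> 2 * trace2 (m (m x y)) = trace2 (m x) * trace2 (m y)"
| "orbit_identities (L6 \<beta>) (m, b) x y \<longleftrightarrow>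
     b x y = \<beta> *s (trace2 (m y) *s x - m x y) \<and> trace2 (m (m x y)) = trace2 (m x) * trace2 (m y)"
| "orbit_identities (L7 \<alpha>) (m, b) x y \<longleftrightarrow> trace2 (m x) = 0 \<and> b x y = \<alpha> *s m x y"
| "orbit_identities Zero (m, b) x y \<longleftrightarrow> m x y = 0 \<and> b x y = 0"

lemma orbit_identities_lp_algebra: "orbit_identities T (lp_algebra T) x y"
  by (cases T) (simp_all add: trace2_def vec_eq_iff forall_2 bil_nth axis_nth_2 algebra_simps)

text \<open>Basis vectors already suffice to compare all pairs of names, and they also fix the
  parameters: in \<open>L7 \<alpha>\<close> the traces vanish, so the identities of
  \<open>L5 \<beta>\<close> leave \<alpha> = \<beta> and those of \<open>L6 \<beta>\<close> leave
  \<alpha> = -\<beta>.\<close>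

lemma lp_algebra_eq_or_degenerates:
  assumes "\<And>x y. orbit_identities T (lp_algebra T') x y"
  shows "T' = T \<or> primary_degeneration\<^sup>+\<^sup>+ T T'"
proof -
  have zero: "primary_degeneration\<^sup>+\<^sup>+ U Zero" if "U \<noteq> Zero" for U
    using that by (cases U)
      (blast intro: primary_degeneration.intros tranclp.intros tranclp_into_tranclp2)+
  have L7: "primary_degeneration\<^sup>+\<^sup>+ L4 (L7 0)"
    by (blast intro: primary_degeneration.intros tranclp.intros)
  note ids = assms[of e1 e1] assms[of e1 e2] assms[of e2 e1] assms[of e2 e2]
  show ?thesis
    using ids zero[of T] L7
    by (cases T; cases T')
      (auto simp: trace2_def vec_eq_iff forall_2 bil_nth axis_nth_2 
        intro: primary_degeneration.intros tranclp.intros(1))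
qed

lemma trace2_conjugate:
  assumes "a * d - b * c \<noteq> 0" "Vector_Spaces.linear (*s) (*s) m" "Vector_Spaces.linear (*s) (*s) n"
    "\<And>x. lin a b c d (m x) = n (lin a b c d x)"
  shows "trace2 n = trace2 m"
proof -
  obtain p q r s where m: "m = lin p q r s" using linear_eq_lin[OF assms(2)] by blast
  obtain t u v w where n: "n = lin t u v w" using linear_eq_lin[OF assms(3)] by blast
  have "a * p + b * r = t * a + u * c" "a * q + b * s = t * b + u * d"
    "c * p + d * r = v * a + w * c" "c * q + d * s = v * b + w * d"
    using assms(4)[of e1] assms(4)[of e2]
    by (simp_all add: m n vec_eq_iff forall_2 lin_nth axis_nth_2)
  \<comment> \<open>The trace of \<open>g m = n g\<close> multiplied by the adjugate of
    \<open>g\<close>: a combination of the four entry equations.\<close>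
  then have "(a * d - b * c) * (t + w) = (a * d - b * c) * (p + s)" by algebra
  then have "t + w = p + s" using assms(1) by simp
  then show ?thesis by (simp add: m n trace2_def lin_nth axis_nth_2)
qed

lemma orbit_identities_isomorphic:
  assumes iso: "lp_isomorphic A B" and bil: "A \<in> Bil2" "B \<in> Bil2" and id: "\<And>x y. orbit_identities T A x y"
  shows "orbit_identities T B x y"
proof -
  obtain m b where A: "A = (m, b)" by (cases A)
  obtain n c where B: "B = (n, c)" by (cases B)
  obtain g where g: "Vector_Spaces.linear (*s) (*s) g" "bij g"
    "\<And>x y. g (m x y) = n (g x) (g y)" "\<And>x y. g (b x y) = c (g x) (g y)"
    using iso unfolding lp_isomorphic_def A B fst_conv snd_conv by blast
  obtain p q r s where gl: "g = lin p q r s" using linear_eq_lin[OF g(1)] by blast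
  have nz: "p * s - q * r \<noteq> 0" using g(2) bij_lin_iff gl by blast
  have lin: "Vector_Spaces.linear (*s) (*s) (m x)" "Vector_Spaces.linear (*s) (*s) (b x)"
    "Vector_Spaces.linear (*s) (*s) (n x)" "Vector_Spaces.linear (*s) (*s) (c x)" for x
    using bil unfolding A B Bil2_def cbilinear_def by auto
  have tr: "trace2 (n (g x)) = trace2 (m x)" "trace2 (c (g x)) = trace2 (b x)" for x
    using trace2_conjugate[OF nz lin(1,3)] trace2_conjugate[OF nz lin(2,4)] g(3,4)
    unfolding gl by blast+
  obtain x' y' where xy: "x = g x'" "y = g y'" using g(2) by (metis bij_pointE)
  interpret g: Vector_Spaces.linear "(*s)" "(*s)" g by (rule g(1))
  have g0: "g 0 = 0" by (rule g.zero)
  have tr2: "trace2 (n (n (g x) (g y))) = trace2 (m (m x y))" for x y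
    using tr(1)[of "m x y"] g(3) by simp
  have unital: "2 *s g (b x' y') = \<beta> *s (2 *s g (m x' y') - trace2 (m x') *s g y')"
    if "2 *s b x' y' = \<beta> *s (2 *s m x' y' - trace2 (m x') *s y')" for \<beta>
    using arg_cong[OF that, of g] by (simp only: g.scale g.diff)
  show ?thesis
    using id[of x' y'] g0
    unfolding A B xy
    by (cases T) (auto simp: tr tr2 g.scale g.diff g.neg unital simp del: vector_ssub_ldistrib simp flip: g(3,4))
qed

text \<open>An expression such as \<open>fst A x y\<close> is polynomial in the structure constants
  only where bilinearity lets it be expanded, so functions are compared with polynomials on
  \<open>Bil2\<close> alone.\<close>

definition bil_polyfun :: "(lp_structure \<Rightarrow> complex) \<Rightarrow> bool" where
  "bil_polyfun f \<longleftrightarrow> (\<exists>g. polyfun g \<and> (\<forall>A\<in>Bil2. f A = g A))"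

lemma bil_polyfun_const: "bil_polyfun (\<lambda>_. c)"
  unfolding bil_polyfun_def by (blast intro: polyfun.const)

lemma bil_polyfun_add: "bil_polyfun f \<Longrightarrow> bil_polyfun g \<Longrightarrow> bil_polyfun (\<lambda>A. f A + g A)"
  unfolding bil_polyfun_def by (elim exE conjE) (rule exI, rule conjI, erule (1) polyfun.add, simp)

lemma bil_polyfun_mult: "bil_polyfun f \<Longrightarrow> bil_polyfun g \<Longrightarrow> bil_polyfun (\<lambda>A. f A * g A)"
  unfolding bil_polyfun_def by (elim exE conjE) (rule exI, rule conjI, erule (1) polyfun.mult, simp)

lemma bil_polyfun_diff: "bil_polyfun f \<Longrightarrow> bil_polyfun g \<Longrightarrow> bil_polyfun (\<lambda>A. f A - g A)"
  using bil_polyfun_add[OF _ bil_polyfun_mult[OF bil_polyfun_const[of "-1"]], of f g] by simp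

text \<open>The arguments may depend on the structure, which covers nested products such as those
  inside the trace identities.\<close>

lemma bil_polyfun_apply:
  assumes "\<And>i. bil_polyfun (\<lambda>A. x A $ i)" "\<And>i. bil_polyfun (\<lambda>A. y A $ i)"
  shows "bil_polyfun (\<lambda>A. fst A (x A) (y A) $ k)" "bil_polyfun (\<lambda>A. snd A (x A) (y A) $ k)"
proof -
  have coord: "bil_polyfun (\<lambda>A. fst A (axis i 1) (axis j 1) $ k)"
    "bil_polyfun (\<lambda>A. snd A (axis i 1) (axis j 1) $ k)" for i j
    unfolding bil_polyfun_def by (blast intro: polyfun.coord_product polyfun.coord_bracket)+
  have cong: "bil_polyfun f" if "bil_polyfun g" "\<And>A. A \<in> Bil2 \<Longrightarrow> f A = g A" for f g
    using that unfolding bil_polyfun_def by simp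
  have eq: "m u v $ k = u $ 1 * v $ 1 * m e1 e1 $ k + u $ 1 * v $ 2 * m e1 e2 $ k +
      u $ 2 * v $ 1 * m e2 e1 $ k + u $ 2 * v $ 2 * m e2 e2 $ k" if "cbilinear m" for m u v
    by (subst cbilinear_eq_bil[OF that]) (rule bil_nth)
  show "bil_polyfun (\<lambda>A. fst A (x A) (y A) $ k)"
    by (rule cong[OF _ eq]) (auto simp: Bil2_def intro!: bil_polyfun_add bil_polyfun_mult coord assms)
  show "bil_polyfun (\<lambda>A. snd A (x A) (y A) $ k)"
    by (rule cong[OF _ eq]) (auto simp: Bil2_def intro!: bil_polyfun_add bil_polyfun_mult coord assms)
qed

lemma closure_bil_polyfun_eq:
  assumes "S \<in> zariski closure_of X" "X \<subseteq> Bil2" "bil_polyfun f" "bil_polyfun g" "\<And>A. A \<in> X \<Longrightarrow> f A = g A"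
  shows "f S = g S"
proof -
  obtain h where h: "polyfun h" "\<And>A. A \<in> Bil2 \<Longrightarrow> f A - g A = h A"
    using bil_polyfun_diff[OF assms(3,4)] unfolding bil_polyfun_def by blast
  have "h S = 0"
  proof (rule closure_polyfun_zero[OF assms(1,2) h(1)])
    show "h A = 0" if "A \<in> X" for A
      using h(2)[of A] assms(2,5) that by auto
  qed
  moreover have "S \<in> Bil2" using assms(1) closure_subset_Bil2 by blast
  ultimately show ?thesis using h(2)[of S] by simp
qed

lemma orbit_identities_closure:
  assumes S: "S \<in> zariski closure_of X" and X: "X \<subseteq> Bil2" and id: "\<And>A x y. A \<in> X \<Longrightarrow> orbit_identities T A x y"
  shows "orbit_identities T S x y"
proof -
  obtain m b where mb: "S = (m, b)" by (cases S)
  note intros = bil_polyfun_const bil_polyfun_diff bil_polyfun_add bil_polyfun_mult bil_polyfun_apply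
  have id': "orbit_identities T (fst A, snd A) x y" if "A \<in> X" for A
    using id[OF that] by simp
  have vec: "F S = G S" if "\<And>A. A \<in> X \<Longrightarrow> F A = G A" "\<And>k. bil_polyfun (\<lambda>A. F A $ k)"
    "\<And>k. bil_polyfun (\<lambda>A. G A $ k)" for F G :: "lp_structure \<Rightarrow> V"
    unfolding vec_eq_iff using closure_bil_polyfun_eq[OF S X that(2,3)] that(1) by simp
  have scal: "f S = g S" if "\<And>A. A \<in> X \<Longrightarrow> f A = g A" "bil_polyfun f" "bil_polyfun g" for f g
    by (rule closure_bil_polyfun_eq[OF S X that(2,3,1)])
  show ?thesis
  proof (cases T)
    case L1
    have "fst S x y = 0"
      by (rule vec) (use id' L1 in \<open>auto intro!: intros\<close>)
    moreover have "snd S x y = snd S y x"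
      by (rule vec) (use id' L1 in \<open>auto intro!: intros\<close>)
    ultimately show ?thesis by (simp add: L1 mb)
  next
    case L2
    have "fst S x y = 0"
      by (rule vec) (use id' L2 in \<open>auto intro!: intros\<close>)
    moreover have "trace2 (snd S x) = 0"
      by (rule scal) (use id' L2 in \<open>auto simp: trace2_def intro!: intros\<close>)
    ultimately show ?thesis by (simp add: L2 mb)
  next
    case L3
    have "fst S x y = 0"
      by (rule vec) (use id' L3 in \<open>auto intro!: intros\<close>)
    \<comment> \<open>Antisymmetry is rewritten as a vanishing sum, whose two sides are built from
      the available polynomial operations.\<close>
    moreover have "snd S x y + snd S y x = 0"
      by (rule vec) (use id' L3 in \<open>auto simp: eq_neg_iff_add_eq_0 intro!: intros\<close>)
    ultimately show ?thesis by (simp add: L3 mb eq_neg_iff_add_eq_0)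
  next
    case L4
    have "snd S x y = 0"
      by (rule vec) (use id' L4 in \<open>auto intro!: intros\<close>)
    then show ?thesis by (simp add: L4 mb)
  next
    case (L5 \<beta>)
    have "2 *s snd S x y = \<beta> *s (2 *s fst S x y - trace2 (fst S x) *s y)"
      by (rule vec) (use id' L5 in \<open>auto simp: trace2_def intro!: intros\<close>)
    moreover have "2 * trace2 (fst S (fst S x y)) = trace2 (fst S x) * trace2 (fst S y)"
      by (rule scal) (use id' L5 in \<open>auto simp: trace2_def intro!: intros\<close>)
    ultimately show ?thesis by (simp add: L5 mb)
  next
    case (L6 \<beta>)
    have "snd S x y = \<beta> *s (trace2 (fst S y) *s x - fst S x y)"
      by (rule vec) (use id' L6 in \<open>auto simp: trace2_def intro!: intros\<close>)
    moreover have "trace2 (fst S (fst S x y)) = trace2 (fst S x) * trace2 (fst S y)"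
      by (rule scal) (use id' L6 in \<open>auto simp: trace2_def intro!: intros\<close>)
    ultimately show ?thesis by (simp add: L6 mb)
  next
    case (L7 \<alpha>)
    have "trace2 (fst S x) = 0"
      by (rule scal) (use id' L7 in \<open>auto simp: trace2_def intro!: intros\<close>)
    moreover have "snd S x y = \<alpha> *s fst S x y"
      by (rule vec) (use id' L7 in \<open>auto intro!: intros\<close>)
    ultimately show ?thesis by (simp add: L7 mb)
  next
    case Zero
    have "fst S x y = 0" "snd S x y = 0"
      by (rule vec; use id' Zero in \<open>auto intro!: intros\<close>)+
    then show ?thesis by (simp add: Zero mb)
  qed
qed

section \<open>The degeneration relation\<close>

lemma GL_orbit_isomorphic: "S \<in> GL_orbit A \<Longrightarrow> lp_isomorphic A S"
  unfolding GL_orbit_def lp_isomorphic_def using act_equivariant[of _ A] by (auto simp: GL_def; blast)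

text \<open>The point \<open>S\<close> of the closure is only isomorphic to the target, so
  invariance of the identities enters twice: along the orbit of \<open>T\<close>, and from
  \<open>S\<close> to \<open>T'\<close>.\<close>

lemma degenerates_cases:
  assumes "degenerates (lp_algebra T) (lp_algebra T')"
  shows "T' = T \<or> primary_degeneration\<^sup>+\<^sup>+ T T'"
proof (rule lp_algebra_eq_or_degenerates)
  fix x y
  obtain S where S: "lp_isomorphic S (lp_algebra T')" "S \<in> zariski closure_of GL_orbit (lp_algebra T)"
    using assms unfolding degenerates_def by blast
  have "orbit_identities T A x y" if "A \<in> GL_orbit (lp_algebra T)" for A x y
    using orbit_identities_isomorphic[OF GL_orbit_isomorphic[OF that] lp_algebra_Bil2 _
        orbit_identities_lp_algebra] that GL_orbit_lp_algebra_subset by blast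
  then have "orbit_identities T S x y" for x y
    by (rule orbit_identities_closure[OF S(2) GL_orbit_lp_algebra_subset])
  then show "orbit_identities T (lp_algebra T') x y"
    using orbit_identities_isomorphic[OF S(1) _ lp_algebra_Bil2] S(2) closure_subset_Bil2 by blast
qed

lemma isomorphic_degenerates:
  assumes "lp_isomorphic (lp_algebra T) B"
  shows "degenerates (lp_algebra T) B"
proof -
  have "lp_algebra T \<in> GL_orbit (lp_algebra T)"
    by (rule in_GL_orbitI[of 1 1 0 0]) (simp_all add: lin_id)
  then have "lp_algebra T \<in> zariski closure_of GL_orbit (lp_algebra T)"
    using closure_of_subset[of "GL_orbit (lp_algebra T)" zariski] GL_orbit_lp_algebra_subset[of T]
    unfolding topspace_zariski by blast
  then show ?thesis
    unfolding degenerates_def using assms by blast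
qed

theorem lemma19:
  shows "(orbit_dim (lp_algebra L4) = 4 \<and>
          orbit_dim (lp_algebra L2) = 3 \<and>
          (\<forall>\<beta>. orbit_dim (lp_algebra (L5 \<beta>)) = 3) \<and>
          (\<forall>\<beta>. orbit_dim (lp_algebra (L6 \<beta>)) = 3) \<and>
          orbit_dim (lp_algebra L1) = 2 \<and>
          orbit_dim (lp_algebra L3) = 2 \<and>
          (\<forall>\<alpha>. orbit_dim (lp_algebra (L7 \<alpha>)) = 2) \<and>
          orbit_dim (lp_algebra Zero) = 0) \<and>
         (\<forall>T T'. degenerates (lp_algebra T) (lp_algebra T') \<longleftrightarrow>
            lp_isomorphic (lp_algebra T) (lp_algebra T') \<or>
            primary_degeneration\<^sup>+\<^sup>+ T T')"
proof (intro conjI allI)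
  show "orbit_dim (lp_algebra L4) = 4" by (simp add: orbit_dim_semisimple_family)
  show "orbit_dim (lp_algebra L2) = 3" by (simp add: orbit_dim_leibniz_family)
  show "orbit_dim (lp_algebra (L5 \<beta>)) = 3" for \<beta>
    using orbit_dim_unital_family[of 1 "- 1" \<beta>] by simp
  show "orbit_dim (lp_algebra (L6 \<beta>)) = 3" for \<beta>
    using orbit_dim_unital_family[of 0 1 \<beta>] by simp
  show "orbit_dim (lp_algebra L1) = 2"
    using orbit_dim_nilpotent_family[of 0 1] by simp
  show "orbit_dim (lp_algebra L3) = 2" by (simp add: orbit_dim_lie_family)
  show "orbit_dim (lp_algebra (L7 \<alpha>)) = 2" for \<alpha>
    using orbit_dim_nilpotent_family[of 1 \<alpha>] by simp
  show "orbit_dim (lp_algebra Zero) = 0" by (simp add: orbit_dim_zero)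
  fix T T'
  show "degenerates (lp_algebra T) (lp_algebra T') \<longleftrightarrow>
      lp_isomorphic (lp_algebra T) (lp_algebra T') \<or> primary_degeneration\<^sup>+\<^sup>+ T T'"
  proof
    assume deg: "degenerates (lp_algebra T) (lp_algebra T')"
    have "lp_isomorphic (lp_algebra T) (lp_algebra T)"
      unfolding lp_isomorphic_def
      by (intro exI[of _ "lin 1 0 0 1"]) (simp add: linear_lin bij_lin_iff lin_id)
    then show "lp_isomorphic (lp_algebra T) (lp_algebra T') \<or> primary_degeneration\<^sup>+\<^sup>+ T T'"
      using degenerates_cases[OF deg] by blast
  next
    assume "lp_isomorphic (lp_algebra T) (lp_algebra T') \<or> primary_degeneration\<^sup>+\<^sup>+ T T'"
    then show "degenerates (lp_algebra T) (lp_algebra T')"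
      using isomorphic_degenerates tranclp_primary_degeneration_degenerates by blast
  qed
qed

end
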